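(* For all integers $g\geq1$ and $r\geq1$, the Krull dimension of the ring of invariants $\mathbb K[T,T',\dots,T^{(r)}]^{\mathbf{SL}_g}$ equals $(r+1)\frac{g(g+1)}{2}-g^2+1$.
   Context: $\mathbb K$ is an algebraically closed field of arbitrary characteristic. $V_g$ is the $\mathbb K$-vector space of symmetric $g\times g$ matrices, on which $\mathbf{SL}_g$ acts by congruence $(\Lambda,Q)\mapsto\Lambda Q\Lambda^t$, and diagonally on $V_g^{r+1}$. The coordinate ring of $V_g^{r+1}$ is the polynomial ring $\mathbb K[T,T',\dots,T^{(r)}]$ in the indeterminates $T^{(l)}_{ij}=T^{(l)}_{ji}$, $1\le i\le j\le g$, $0\le l\le r$ (the entries of symmetric matrices $T^{(l)}$), and $\Lambda\in\mathbf{SL}_g$ acts by $F(T,\dots,T^{(r)})\mapsto F(\Lambda^{-1}T(\Lambda^{-1})^t,\dots,\Lambda^{-1}T^{(r)}(\Lambda^{-1})^t)$. *)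

theory Defs
  imports
    "HOL-Library.Poly_Mapping"
    "HOL-Library.Extended_Nat"
    "HOL-Algebra.Ideal"
    "Jordan_Normal_Form.Determinant"
begin

text \<open>
  Supremum of the lengths \<open>n\<close> of strict chains \<open>P 0 \<subset> \<dots> \<subset> P n\<close> of prime ideals. The convention
  \<open>Sup {} = 0\<close> on \<^typ>\<open>enat\<close> makes the zero ring have dimension 0.
\<close>

definition krull_dim :: "('a, 'b) ring_scheme \<Rightarrow> enat" where
  "krull_dim R = (SUP n \<in> {n. \<exists>P :: nat \<Rightarrow> 'a set.
      (\<forall>i\<le>n. primeideal (P i) R) \<and> (\<forall>i<n. P i \<subset> P (Suc i))}. enat n)"

definition SL :: "nat \<Rightarrow> 'k::field mat monoid" where
  "SL g = \<lparr>carrier = {A \<in> carrier_mat g g. det A = 1}, monoid.mult = (*), one = 1\<^sub>m g\<rparr>"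

text \<open>
  The triple \<open>(l, i, j)\<close> stands for the indeterminate in position \<open>(i, j)\<close> of the \<open>l\<close>-th symmetric
  matrix; rows and columns are numbered from 0. Polynomials are finitely supported functions from
  exponent vectors to coefficients.
\<close>

type_synonym tvar = "nat \<times> nat \<times> nat"
type_synonym 'k tpoly = "(tvar \<Rightarrow>\<^sub>0 nat) \<Rightarrow>\<^sub>0 'k"

definition tvars :: "nat \<Rightarrow> nat \<Rightarrow> tvar set" where
  "tvars g r = {(l, i, j). l \<le> r \<and> i \<le> j \<and> j < g}"

definition tpoly_ring :: "nat \<Rightarrow> nat \<Rightarrow> 'k::field tpoly ring" where
  "tpoly_ring g r = \<lparr>carrier = {F. \<forall>m \<in> Poly_Mapping.keys F. Poly_Mapping.keys m \<subseteq> tvars g r},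
     monoid.mult = (*), one = 1, zero = 0, add = (+)\<rparr>"

definition tconst :: "'k::field \<Rightarrow> 'k tpoly" where
  "tconst c = Poly_Mapping.single 0 c"

definition tvar :: "tvar \<Rightarrow> 'k::field tpoly" where
  "tvar v = Poly_Mapping.single (Poly_Mapping.single v 1) 1"

definition tsubst :: "(tvar \<Rightarrow> 'k tpoly) \<Rightarrow> 'k::field tpoly \<Rightarrow> 'k tpoly" where
  "tsubst \<sigma> F = (\<Sum>m \<in> Poly_Mapping.keys F.
     tconst (Poly_Mapping.lookup F m) * (\<Prod>v \<in> Poly_Mapping.keys m. \<sigma> v ^ Poly_Mapping.lookup m v))"

definition generic_sym_mat :: "nat \<Rightarrow> nat \<Rightarrow> 'k::field tpoly mat" where
  "generic_sym_mat g l = mat g g (\<lambda>(i, j). tvar (l, min i j, max i j))"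

definition SL_act :: "nat \<Rightarrow> 'k::field mat \<Rightarrow> 'k tpoly \<Rightarrow> 'k tpoly" where
  "SL_act g \<Lambda> F =
    (let M = map_mat tconst (inv\<^bsub>SL g\<^esub> \<Lambda>)
     in tsubst (\<lambda>(l, i, j). (M * generic_sym_mat g l * transpose_mat M) $$ (i, j)) F)"

definition SL_invariant_ring :: "nat \<Rightarrow> nat \<Rightarrow> 'k::field tpoly ring" where
  "SL_invariant_ring g r = (tpoly_ring g r)
     \<lparr>carrier := {F \<in> carrier (tpoly_ring g r). \<forall>\<Lambda> \<in> carrier (SL g). SL_act g \<Lambda> F = F}\<rparr>"

end

theory Submission
  imports
    Defs
    "Jordan_Normal_Form.Char_Poly"
    "HOL-Library.Function_Algebras"
begin

text \<open>
  Let \<open>S\<close> be the linear space of tuples \<open>(c I, diag(a), T'', \<dots>)\<close>; its dimension is the number in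
  the theorem. A pencil \<open>(T, T')\<close> with \<open>det T \<noteq> 0\<close> and simple eigenvalues is diagonalised by an
  element of \<open>SL\<^sub>g\<close> that turns \<open>T\<close> into a scalar matrix (only square roots and a \<open>g\<close>-th root are
  needed, so the characteristic plays no role). Hence \<open>SL\<^sub>g S\<close> is dense and restriction to \<open>S\<close> is
  injective on invariants.

  Upper bound: elements \<open>x\<^sub>i \<in> P\<^sub>i\<^sub>+\<^sub>1 - P\<^sub>i\<close> chosen along a chain of primes are algebraically
  independent, while more than \<open>dim S\<close> polynomial functions on \<open>S\<close> are dependent by counting
  monomials.

  Lower bound: fix the coordinates of \<open>S\<close> one at a time, first \<open>c = 1\<close>, then \<open>a\<^sub>i = \<alpha>\<^sub>i\<close> for distinct
  scalars \<open>\<alpha>\<^sub>i\<close>, then \<open>T\<^sup>(\<^sup>l\<^sup>)\<^sub>i\<^sub>j = 0\<close>. The invariants vanishing on the resulting subspaces form primes,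
  and the inclusions are strict because of the invariants \<open>det T - 1\<close>, \<open>det (\<alpha>\<^sub>i T - T')\<close> and
  \<open>tr (B\<^sub>i T\<^sup>(\<^sup>l\<^sup>) B\<^sub>j T\<^sup>(\<^sup>l\<^sup>))\<close> with \<open>B\<^sub>i = adj (\<alpha>\<^sub>i T - T')\<close>: for \<open>T = I\<close> and \<open>T' = diag(\<alpha>)\<close> the
  last one is a nonzero multiple of the square of \<open>T\<^sup>(\<^sup>l\<^sup>)\<^sub>i\<^sub>j\<close>. This avoids finite generation of the
  ring of invariants.
\<close>

section \<open>Evaluation of polynomials\<close>

text \<open>Over a finite field the product of all \<open>X - a\<close>, plus 1, would have positive
  degree and take the value 1 everywhere, hence have no root.\<close>

lemma infinite_UNIV_alg_closed: "infinite (UNIV :: 'k::alg_closed_field set)"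
proof
  assume fin: "finite (UNIV :: 'k set)"
  define p where "p = (\<Prod>a\<in>(UNIV :: 'k set). [:- a, 1:]) + 1"
  have "degree (\<Prod>a\<in>(UNIV :: 'k set). [:- a, 1:]) = (\<Sum>a\<in>(UNIV :: 'k set). degree [:- a, 1:])"
    by (rule degree_prod_eq_sum_degree) auto
  then have deg: "degree (\<Prod>a\<in>(UNIV :: 'k set). [:- a, 1:]) = card (UNIV :: 'k set)"
    by simp
  have "card (UNIV :: 'k set) > 0"
    using fin by (simp add: card_gt_0_iff)
  then have "degree p > 0"
    unfolding p_def by (subst degree_add_eq_left) (simp_all add: deg)
  then obtain x where "poly p x = 0"
    using alg_closed_imp_poly_has_root by blast
  moreover have "poly p x = 1"
    using fin by (auto simp: p_def poly_prod intro!: prod_zero)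
  ultimately show False by simp
qed

section \<open>Evaluation and substitution as ring homomorphisms\<close>

definition monom_eval :: "('v \<Rightarrow> 'b::comm_ring_1) \<Rightarrow> ('v \<Rightarrow>\<^sub>0 nat) \<Rightarrow> 'b" where
  "monom_eval \<sigma> m = (\<Prod>v\<in>Poly_Mapping.keys m. \<sigma> v ^ Poly_Mapping.lookup m v)"

text \<open>The coefficient map \<open>h\<close> is general so that three cases share one theory:
  evaluation at a point (identity), substitution of polynomials (\<open>tconst\<close>), and
  restriction to a line (constants of a univariate polynomial ring).\<close>

definition poly_eval ::
    "('k::zero \<Rightarrow> 'b::comm_ring_1) \<Rightarrow> ('v \<Rightarrow> 'b) \<Rightarrow> (('v \<Rightarrow>\<^sub>0 nat) \<Rightarrow>\<^sub>0 'k) \<Rightarrow> 'b" where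
  "poly_eval h \<sigma> F =
     (\<Sum>m\<in>Poly_Mapping.keys F. h (Poly_Mapping.lookup F m) * monom_eval \<sigma> m)"

abbreviation eval :: "('v \<Rightarrow> 'k::field) \<Rightarrow> (('v \<Rightarrow>\<^sub>0 nat) \<Rightarrow>\<^sub>0 'k) \<Rightarrow> 'k" where
  "eval \<equiv> poly_eval (\<lambda>c. c)"

lemma monom_eval_superset:
  assumes "finite X" "Poly_Mapping.keys m \<subseteq> X"
  shows "monom_eval \<sigma> m = (\<Prod>v\<in>X. \<sigma> v ^ Poly_Mapping.lookup m v)"
  unfolding monom_eval_def
  by (rule prod.mono_neutral_left) (use assms in \<open>auto simp: in_keys_iff\<close>)

lemma monom_eval_0 [simp]: "monom_eval \<sigma> 0 = 1"
  by (simp add: monom_eval_def)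

lemma monom_eval_add: "monom_eval \<sigma> (m + n) = monom_eval \<sigma> m * monom_eval \<sigma> n"
proof -
  let ?X = "Poly_Mapping.keys m \<union> Poly_Mapping.keys n"
  have "monom_eval \<sigma> (m + n) = (\<Prod>v\<in>?X. \<sigma> v ^ Poly_Mapping.lookup (m + n) v)"
    by (rule monom_eval_superset) (use keys_add[of m n] in auto)
  also have "\<dots> = (\<Prod>v\<in>?X. \<sigma> v ^ Poly_Mapping.lookup m v) * (\<Prod>v\<in>?X. \<sigma> v ^ Poly_Mapping.lookup n v)"
    by (simp add: lookup_add power_add prod.distrib)
  also have "\<dots> = monom_eval \<sigma> m * monom_eval \<sigma> n"
    by (simp add: monom_eval_superset[of ?X])
  finally show ?thesis .
qed

lemma poly_mapping_sum_single:
  "F = (\<Sum>m\<in>Poly_Mapping.keys F. Poly_Mapping.single m (Poly_Mapping.lookup F m))"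
  by (rule poly_mapping_eqI)
     (auto simp: lookup_sum lookup_single when_def in_keys_iff cong: if_cong)

context comm_ring_hom
begin

lemma poly_eval_superset:
  assumes "finite X" "Poly_Mapping.keys F \<subseteq> X"
  shows "poly_eval hom \<sigma> F = (\<Sum>m\<in>X. hom (Poly_Mapping.lookup F m) * monom_eval \<sigma> m)"
  unfolding poly_eval_def
  by (rule sum.mono_neutral_left) (use assms in \<open>auto simp: in_keys_iff hom_zero\<close>)

lemma poly_eval_single [simp]: "poly_eval hom \<sigma> (Poly_Mapping.single m c) = hom c * monom_eval \<sigma> m"
  by (subst poly_eval_superset[of "{m}"]) auto

lemma poly_eval_add: "poly_eval hom \<sigma> (F + G) = poly_eval hom \<sigma> F + poly_eval hom \<sigma> G"
proof -
  let ?X = "Poly_Mapping.keys F \<union> Poly_Mapping.keys G"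
  show ?thesis
    using keys_add[of F G]
    by (simp add: poly_eval_superset[of ?X] lookup_add hom_add distrib_right sum.distrib)
qed

lemma poly_eval_0 [simp]: "poly_eval hom \<sigma> 0 = 0"
  by (simp add: poly_eval_def)

lemma poly_eval_sum: "poly_eval hom \<sigma> (\<Sum>i\<in>I. f i) = (\<Sum>i\<in>I. poly_eval hom \<sigma> (f i))"
  by (induction I rule: infinite_finite_induct) (auto simp: poly_eval_add)

lemma poly_eval_mult: "poly_eval hom \<sigma> (F * G) = poly_eval hom \<sigma> F * poly_eval hom \<sigma> G"
proof -
  have "poly_eval hom \<sigma> (F * G) = poly_eval hom \<sigma>
      ((\<Sum>m\<in>Poly_Mapping.keys F. Poly_Mapping.single m (Poly_Mapping.lookup F m)) *
       (\<Sum>n\<in>Poly_Mapping.keys G. Poly_Mapping.single n (Poly_Mapping.lookup G n)))"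
    by (simp flip: poly_mapping_sum_single)
  also have "\<dots> = poly_eval hom \<sigma> F * poly_eval hom \<sigma> G"
    unfolding poly_eval_def[of _ _ F] poly_eval_def[of _ _ G]
    by (simp add: sum_product mult_single poly_eval_sum hom_mult monom_eval_add mult_ac)
  finally show ?thesis .
qed

lemma comm_ring_hom_poly_eval: "comm_ring_hom (poly_eval hom \<sigma>)"
proof
  show "poly_eval hom \<sigma> 1 = 1"
    using poly_eval_single[of \<sigma> 0 1] by (simp del: poly_eval_single add: hom_one)
qed (auto simp: poly_eval_add poly_eval_mult)

lemma hom_monom_eval: "hom (monom_eval \<sigma> m) = monom_eval (\<lambda>v. hom (\<sigma> v)) m"
  by (simp add: monom_eval_def hom_prod hom_power)

lemma hom_poly_eval: "hom (poly_eval h \<sigma> F) = poly_eval (\<lambda>c. hom (h c)) (\<lambda>v. hom (\<sigma> v)) F"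
  by (simp add: poly_eval_def hom_sum hom_mult hom_monom_eval)

end

lemma monom_eval_cong:
  assumes "\<And>v. v \<in> Poly_Mapping.keys m \<Longrightarrow> \<sigma> v = \<tau> v"
  shows "monom_eval \<sigma> m = monom_eval \<tau> m"
  using assms by (simp add: monom_eval_def)

text \<open>Scaling one coordinate is the translation of characters that separates two monomials
  with different exponents at \<open>v\<close>.\<close>

lemma monom_eval_scale:
  "monom_eval (\<sigma>(v := t * \<sigma> v)) m = t ^ Poly_Mapping.lookup m v * monom_eval \<sigma> m"
proof -
  let ?X = "insert v (Poly_Mapping.keys m)"
  have "monom_eval (\<sigma>(v := t * \<sigma> v)) m
      = (t * \<sigma> v) ^ Poly_Mapping.lookup m v *
        (\<Prod>w\<in>Poly_Mapping.keys m - {v}. \<sigma> w ^ Poly_Mapping.lookup m w)"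
    by (subst monom_eval_superset[of ?X]) (auto simp: prod.insert_remove intro!: prod.cong)
  also have "\<dots> = t ^ Poly_Mapping.lookup m v * monom_eval \<sigma> m"
    by (subst monom_eval_superset[of ?X]) (auto simp: prod.insert_remove power_mult_distrib)
  finally show ?thesis .
qed

lemma comm_ring_hom_id: "comm_ring_hom (\<lambda>c::'k::comm_ring_1. c)"
  by standard auto

interpretation eval: comm_ring_hom "eval \<sigma>" for \<sigma> :: "'v \<Rightarrow> 'k::field"
  by (rule comm_ring_hom.comm_ring_hom_poly_eval[OF comm_ring_hom_id])

lemma comm_ring_hom_tconst: "comm_ring_hom (tconst :: 'k::field \<Rightarrow> 'k tpoly)"
  by standard (auto simp: tconst_def single_add mult_single)

lemma tsubst_eq_poly_eval: "tsubst \<sigma> F = poly_eval tconst \<sigma> F"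
  by (simp add: tsubst_def poly_eval_def monom_eval_def)

interpretation tsubst: comm_ring_hom "tsubst \<sigma> :: 'k::field tpoly \<Rightarrow> 'k tpoly" for \<sigma>
  unfolding tsubst_eq_poly_eval
  by (rule comm_ring_hom.comm_ring_hom_poly_eval[OF comm_ring_hom_tconst])

lemma eval_tconst [simp]: "eval \<sigma> (tconst c) = c"
  unfolding tconst_def by (subst comm_ring_hom.poly_eval_single[OF comm_ring_hom_id]) simp

lemma eval_tvar [simp]: "eval \<sigma> (tvar v) = \<sigma> v"
  unfolding tvar_def
  by (subst comm_ring_hom.poly_eval_single[OF comm_ring_hom_id]) (simp add: monom_eval_def)

lemma eval_tsubst: "eval \<sigma> (tsubst \<tau> F) = eval (\<lambda>v. eval \<sigma> (\<tau> v)) F"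
  by (simp add: tsubst_eq_poly_eval eval.hom_poly_eval)

text \<open>Dedekind's argument: distinct monomials are distinct characters of the multiplicative monoid
  of all points.\<close>

lemma monom_eval_independent:
  fixes c :: "('v \<Rightarrow>\<^sub>0 nat) \<Rightarrow> 'k::alg_closed_field"
  assumes "finite M" and "\<And>\<sigma>. (\<Sum>m\<in>M. c m * monom_eval \<sigma> m) = 0" and "m \<in> M"
  shows "c m = 0"
  using assms
proof (induction M arbitrary: c m rule: finite_induct)
  case (insert n M)
  have M0: "c m = 0" if m: "m \<in> M" for m
  proof -
    have "m \<noteq> n" using insert.hyps m by auto
    then obtain v where v: "Poly_Mapping.lookup m v \<noteq> Poly_Mapping.lookup n v"
      by (metis poly_mapping_eqI)
    let ?a = "Poly_Mapping.lookup m v" and ?b = "Poly_Mapping.lookup n v"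
    have "Polynomial.monom 1 ?a \<noteq> (Polynomial.monom 1 ?b :: 'k poly)"
      using v by (metis degree_monom_eq zero_neq_one)
    then have "finite {t. poly (Polynomial.monom 1 ?a - Polynomial.monom 1 ?b) (t::'k) = 0}"
      by (intro poly_roots_finite) auto
    then have "{t. poly (Polynomial.monom 1 ?a - Polynomial.monom 1 ?b) (t::'k) = 0} \<noteq> UNIV"
      using infinite_UNIV_alg_closed by metis
    then obtain t :: 'k where t: "t ^ ?a \<noteq> t ^ ?b"
      by (auto simp: poly_monom)
    \<comment> \<open>Take the relation at the point scaled by \<open>t\<close> in coordinate
      \<open>v\<close> and subtract \<open>t ^ ?b\<close> times the original one. The term of
      \<open>n\<close> cancels, which leaves a relation supported on \<open>M\<close>.\<close>
    have "c m * (t ^ ?a - t ^ ?b) = 0"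
    proof (rule insert.IH[OF _ m, of "\<lambda>m. c m * (t ^ Poly_Mapping.lookup m v - t ^ ?b)"])
      fix \<sigma> :: "'v \<Rightarrow> 'k"
      have "(\<Sum>m\<in>insert n M. c m * (t ^ Poly_Mapping.lookup m v - t ^ ?b) * monom_eval \<sigma> m)
          = (\<Sum>m\<in>insert n M. c m * monom_eval (\<sigma>(v := t * \<sigma> v)) m)
            - t ^ ?b * (\<Sum>m\<in>insert n M. c m * monom_eval \<sigma> m)"
        unfolding monom_eval_scale sum_distrib_left sum_subtractf[symmetric]
        by (rule sum.cong) (auto simp: algebra_simps)
      also have "\<dots> = 0" by (simp only: insert.prems) simp
      finally show "(\<Sum>m\<in>M. c m * (t ^ Poly_Mapping.lookup m v - t ^ ?b) * monom_eval \<sigma> m) = 0"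
        using insert.hyps by simp
    qed
    then show ?thesis using t by simp
  qed
  have "c n * monom_eval (\<lambda>_. 1) n = 0"
    using insert.prems(1)[of "\<lambda>_. 1"] insert.hyps M0 by simp
  then have "c n = 0"
    by (simp add: monom_eval_def)
  with M0 insert.prems(2) show ?case by auto
qed simp

lemma eval_eq_0_imp_eq_0:
  fixes F :: "('v \<Rightarrow>\<^sub>0 nat) \<Rightarrow>\<^sub>0 'k::alg_closed_field"
  assumes "\<And>\<sigma>. eval \<sigma> F = 0"
  shows "F = 0"
proof (rule poly_mapping_eqI)
  fix m
  show "Poly_Mapping.lookup F m = Poly_Mapping.lookup 0 m"
  proof (cases "m \<in> Poly_Mapping.keys F")
    case True
    then show ?thesis
      using monom_eval_independent[OF finite_keys, where c = "Poly_Mapping.lookup F" and m = m] assms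
      by (auto simp: poly_eval_def)
  qed (auto simp: in_keys_iff)
qed

lemma eval_eqI:
  fixes F G :: "('v \<Rightarrow>\<^sub>0 nat) \<Rightarrow>\<^sub>0 'k::alg_closed_field"
  assumes "\<And>\<sigma>. eval \<sigma> F = eval \<sigma> G"
  shows "F = G"
  using eval_eq_0_imp_eq_0[of "F - G"] assms by (simp add: eval.hom_minus)

text \<open>The line through two points of an affine space \<open>W\<close> is enough to see that \<open>W\<close> is irreducible.\<close>

lemma eval_irreducible:
  fixes F G :: "('v \<Rightarrow>\<^sub>0 nat) \<Rightarrow>\<^sub>0 'k::alg_closed_field"
  assumes aff: "\<And>\<sigma> \<tau> t. \<sigma> \<in> W \<Longrightarrow> \<tau> \<in> W \<Longrightarrow> (\<lambda>v. \<sigma> v + t * (\<tau> v - \<sigma> v)) \<in> W"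
    and FG: "\<And>\<sigma>. \<sigma> \<in> W \<Longrightarrow> eval \<sigma> (F * G) = 0"
    and \<tau>: "\<tau> \<in> W" "eval \<tau> G \<noteq> 0" and \<sigma>: "\<sigma> \<in> W"
  shows "eval \<sigma> F = 0"
proof (rule ccontr)
  assume F: "eval \<sigma> F \<noteq> 0"
  \<comment> \<open>\<open>L\<close> restricts a polynomial to the line with parameter 0 at
    \<open>\<sigma>\<close> and 1 at \<open>\<tau>\<close>. Both \<open>L F\<close> and
    \<open>L G\<close> are nonzero univariate polynomials, so their product is nonzero at some point
    of the line, which lies in \<open>W\<close>.\<close>
  define L where "L = poly_eval (\<lambda>c. [:c:]) (\<lambda>v. [:\<sigma> v, \<tau> v - \<sigma> v:])"
  have L: "poly (L H) t = eval (\<lambda>v. \<sigma> v + t * (\<tau> v - \<sigma> v)) H" for H t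
  proof -
    have hom: "comm_ring_hom (\<lambda>p. poly p t)" by standard auto
    show ?thesis unfolding L_def by (subst comm_ring_hom.hom_poly_eval[OF hom]) simp
  qed
  have "poly (L F) 0 \<noteq> 0" "poly (L G) 1 \<noteq> 0"
    using F \<tau> by (simp_all add: L)
  then have "L F * L G \<noteq> 0" by auto
  then have "finite {t. poly (L F * L G) t = 0}" by (rule poly_roots_finite)
  then obtain t where "poly (L F * L G) t \<noteq> 0"
    using infinite_UNIV_alg_closed by (metis (mono_tags, lifting) UNIV_eq_I mem_Collect_eq)
  then show False
    using FG[OF aff[OF \<sigma> \<tau>(1)], of t] by (simp add: L eval.hom_mult)
qed

section \<open>Chains of primes and algebraic independence\<close>

text \<open>Induction along the chain: divide by the lowest power of \<open>x 0\<close>, which is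
  allowed by primality of \<open>P 0\<close>, then reduce modulo \<open>P 1\<close>. Only the terms
  with that lowest exponent survive, and they form a polynomial in the remaining \<open>x i\<close>
  for the shifted chain. Claiming \<open>\<notin> P 0\<close> instead of \<open>\<noteq> 0\<close>
  is what lets the induction pass from one prime to the next.\<close>

lemma prime_chain_monomials_independent:
  fixes R :: "'a::comm_ring_1 ring" and h :: "'k::field \<Rightarrow> 'a"
  assumes R: "monoid.mult R = (*)" "ring.add R = (+)" "ring.zero R = 0" "monoid.one R = 1"
    and h: "comm_ring_hom h" "\<And>c. h c \<in> carrier R"
    and P: "\<And>i. i \<le> n \<Longrightarrow> primeideal (P i) R" "\<And>i. i < n \<Longrightarrow> P i \<subseteq> P (Suc i)"
    and x: "\<And>i. i < n \<Longrightarrow> x i \<in> P (Suc i) - P i"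
    and E: "finite E" "E \<noteq> {}" "\<And>e. e \<in> E \<Longrightarrow> length e = n" "\<And>e. e \<in> E \<Longrightarrow> c e \<noteq> 0"
  shows "(\<Sum>e\<in>E. h (c e) * (\<Prod>i<n. x i ^ (e ! i))) \<notin> P 0"
  using P x E
proof (induction n arbitrary: P x E c)
  case 0
  interpret h: comm_ring_hom h by fact
  interpret primeideal "P 0" R using "0.prems" by simp
  have "E = {[]}" using 0 by auto
  then have "(\<Sum>e\<in>E. h (c e) * (\<Prod>i<0. x i ^ (e ! i))) = h (c [])" by simp
  \<comment> \<open>A nonzero scalar is a unit of \<open>R\<close>, so it avoids the proper ideal
    \<open>P 0\<close>.\<close>
  moreover have "h (c []) \<notin> P 0"
  proof
    assume "h (c []) \<in> P 0"
    then have "h (inverse (c [])) * h (c []) \<in> P 0"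
      using I_l_closed[of "h (c [])" "h (inverse (c []))"] h(2) by (simp add: R)
    moreover have "c [] \<noteq> 0" using 0 \<open>E = {[]}\<close> by auto
    ultimately have "\<one>\<^bsub>R\<^esub> \<in> P 0" by (simp add: R flip: h.hom_mult)
    then show False using one_imp_carrier I_notcarr by simp
  qed
  ultimately show ?case by simp
next
  case (Suc n)
  interpret h: comm_ring_hom h by fact
  interpret P0: primeideal "P 0" R using Suc.prems by simp
  interpret P1: primeideal "P (Suc 0)" R using Suc.prems by simp
  have xR: "x i \<in> carrier R" if "i < Suc n" for i
  proof -
    interpret Pi: primeideal "P (Suc i)" R using Suc.prems(1)[of "Suc i"] that by simp
    show ?thesis using Suc.prems(3)[of i] that Pi.a_subset by auto
  qed
  have mult: "a * b \<in> carrier R" if "a \<in> carrier R" "b \<in> carrier R" for a b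
    using P0.m_closed[OF that] by (simp add: R)
  have one: "1 \<in> carrier R" using P0.one_closed by (simp add: R)
  have pow: "a ^ k \<in> carrier R" if "a \<in> carrier R" for a k
    using that by (induction k) (auto intro: mult one)
  have prod: "(\<Prod>i\<in>I. f i) \<in> carrier R" if "\<And>i. i \<in> I \<Longrightarrow> f i \<in> carrier R" for I :: "nat set" and f
    using that by (induction I rule: infinite_finite_induct) (auto intro: mult one)
  have add: "a + b \<in> carrier R" if "a \<in> carrier R" "b \<in> carrier R" for a b
    using P0.a_closed[OF that] by (simp add: R)
  have zero: "0 \<in> carrier R" using P0.zero_closed by (simp add: R)
  have sum: "(\<Sum>i\<in>I. f i) \<in> carrier R" if "\<And>i. i \<in> I \<Longrightarrow> f i \<in> carrier R" for I :: "nat list set" and f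
    using that by (induction I rule: infinite_finite_induct) (auto intro: add zero)
  have add1: "a + b \<in> P (Suc 0)" if "a \<in> P (Suc 0)" "b \<in> P (Suc 0)" for a b
    using P1.a_closed[OF that] by (simp add: R)
  have zero1: "0 \<in> P (Suc 0)"
    using additive_subgroup.zero_closed[OF P1.additive_subgroup_axioms] by (simp add: R)
  have sum1: "(\<Sum>i\<in>I. f i) \<in> P (Suc 0)" if "\<And>i. i \<in> I \<Longrightarrow> f i \<in> P (Suc 0)" for I :: "nat list set" and f
    using that by (induction I rule: infinite_finite_induct) (auto intro: add1 zero1)
  have mult1: "a * b \<in> P (Suc 0)" if "a \<in> carrier R" "b \<in> P (Suc 0)" for a b
    using P1.I_l_closed[OF that(2,1)] by (simp add: R)
  \<comment> \<open>Powers of \<open>x 0\<close> can be cancelled modulo \<open>P 0\<close> because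
    \<open>x 0 \<notin> P 0\<close>.\<close>
  have prime0: "b \<in> P 0" if "x 0 ^ k * b \<in> P 0" "b \<in> carrier R" for k b
    using that
  proof (induction k)
    case (Suc k)
    have "x 0 * (x 0 ^ k * b) \<in> P 0" using Suc.prems by (simp add: mult_ac)
    then have "x 0 ^ k * b \<in> P 0"
      using P0.I_prime[of "x 0" "x 0 ^ k * b"] Suc.prems(2) \<open>\<And>i. i < Suc n \<Longrightarrow> x i \<in> P (Suc i) - P i\<close>[of 0]
        mult[OF pow[OF xR[of 0]]] xR[of 0] by (auto simp: R)
    then show ?case using Suc.IH Suc.prems by simp
  qed simp
  \<comment> \<open>\<open>k\<close> is the lowest exponent of \<open>x 0\<close> that occurs;
    \<open>E'\<close> collects the tails of the exponent vectors attaining it, and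
    \<open>rest e\<close> is the term of \<open>e\<close> divided by \<open>x 0 ^ k\<close>.\<close>
  define k where "k = Min (hd ` E)"
  have k: "k \<le> hd e" if "e \<in> E" for e
    unfolding k_def using Suc.prems that by auto
  have "k \<in> hd ` E" unfolding k_def using Suc.prems by (intro Min_in) auto
  define mon where "mon e = (\<Prod>i<n. x (Suc i) ^ (e ! i))" for e
  define E' where "E' = tl ` {e \<in> E. hd e = k}"
  define rest where "rest e = h (c e) * (x 0 ^ (hd e - k) * mon (tl e))" for e
  have E_Cons: "\<exists>e'. e = hd e # e' \<and> length e' = n" if "e \<in> E" for e
    using Suc.prems(6)[OF that] by (cases e) auto
  have monR: "mon e \<in> carrier R" for e
    unfolding mon_def by (intro prod pow xR) simp
  have restR: "rest e \<in> carrier R" for e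
    unfolding rest_def by (intro mult h monR pow xR) simp
  have "h (c e) * (\<Prod>i<Suc n. x i ^ (e ! i)) = x 0 ^ k * rest e" if eE: "e \<in> E" for e
  proof -
    obtain j e' where e: "e = j # e'" using E_Cons[OF eE] by blast
    have "(\<Prod>i<Suc n. x i ^ (e ! i)) = x 0 ^ hd e * mon (tl e)"
      unfolding mon_def e by (simp add: prod.lessThan_Suc_shift del: prod.lessThan_Suc)
    also have "x 0 ^ hd e = x 0 ^ k * x 0 ^ (hd e - k)"
      using k[OF eE] by (simp flip: power_add)
    finally show ?thesis by (simp add: rest_def mult_ac)
  qed
  then have eq: "(\<Sum>e\<in>E. h (c e) * (\<Prod>i<Suc n. x i ^ (e ! i))) = x 0 ^ k * (\<Sum>e\<in>E. rest e)"
    by (simp add: sum_distrib_left cong: sum.cong)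
  have split: "(\<Sum>e\<in>E. rest e) = (\<Sum>e\<in>{e\<in>E. hd e = k}. rest e) + (\<Sum>e\<in>{e\<in>E. hd e \<noteq> k}. rest e)"
    using Suc.prems(4) by (subst sum.union_disjoint[symmetric]) (auto intro!: sum.cong)
  have low: "(\<Sum>e\<in>{e\<in>E. hd e = k}. rest e) = (\<Sum>e\<in>E'. h (c (k # e)) * mon e)"
    unfolding E'_def
  proof (subst sum.reindex)
    show "inj_on tl {e \<in> E. hd e = k}"
      by (rule inj_onI) (metis (mono_tags, lifting) E_Cons length_0_conv list.sel(1,3) list.exhaust_sel list.distinct(1) mem_Collect_eq)
    show "(\<Sum>e\<in>{e\<in>E. hd e = k}. rest e)
        = (\<Sum>e\<in>{e\<in>E. hd e = k}. ((\<lambda>e. h (c (k # e)) * mon e) \<circ> tl) e)"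
    proof (rule sum.cong)
      fix e assume e: "e \<in> {e\<in>E. hd e = k}"
      then have "k # tl e = e" using E_Cons[of e] by (cases e) auto
      with e show "rest e = ((\<lambda>e. h (c (k # e)) * mon e) \<circ> tl) e"
        by (auto simp: rest_def)
    qed simp
  qed
  \<comment> \<open>These terms keep a factor \<open>x 0\<close>, which lies in
    \<open>P (Suc 0)\<close>.\<close>
  have high: "(\<Sum>e\<in>{e\<in>E. hd e \<noteq> k}. rest e) \<in> P (Suc 0)"
  proof (rule sum1)
    fix e assume e: "e \<in> {e\<in>E. hd e \<noteq> k}"
    define j where "j = hd e - k - 1"
    have j: "hd e - k = Suc j" using e k[of e] by (auto simp: j_def)
    have "rest e = (h (c e) * (x 0 ^ j * mon (tl e))) * x 0"
      by (simp add: rest_def j mult_ac)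
    also have "\<dots> \<in> P (Suc 0)"
      by (intro mult1 mult h monR pow xR) (use Suc.prems(3)[of 0] in auto)
    finally show "rest e \<in> P (Suc 0)" .
  qed
  have IH: "(\<Sum>e\<in>E'. h (c (k # e)) * mon e) \<notin> P (Suc 0)"
    unfolding mon_def
  proof (rule Suc.IH[of "\<lambda>i. P (Suc i)" "\<lambda>i. x (Suc i)" E' "\<lambda>e. c (k # e)"])
    show "finite E'" using Suc.prems by (simp add: E'_def)
    show "E' \<noteq> {}" using \<open>k \<in> hd ` E\<close> by (auto simp: E'_def)
    show "length e = n" if "e \<in> E'" for e
      using that Suc.prems(6) by (auto simp: E'_def)
    show "c (k # e) \<noteq> 0" if eE': "e \<in> E'" for e
    proof -
      obtain e0 where e0: "e0 \<in> E" "hd e0 = k" "e = tl e0" using eE' by (auto simp: E'_def)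
      then have "k # e = e0" using E_Cons[of e0] by (cases e0) auto
      then show ?thesis using Suc.prems(7) e0 by simp
    qed
    show "primeideal (P (Suc i)) R" if "i \<le> n" for i
      by (rule Suc.prems(1)) (use that in simp)
    show "P (Suc i) \<subseteq> P (Suc (Suc i))" if "i < n" for i
      by (rule Suc.prems(2)) (use that in simp)
    show "x (Suc i) \<in> P (Suc (Suc i)) - P (Suc i)" if "i < n" for i
      by (rule Suc.prems(3)) (use that in simp)
  qed
  show ?case
  proof
    assume "(\<Sum>e\<in>E. h (c e) * (\<Prod>i<Suc n. x i ^ (e ! i))) \<in> P 0"
    then have "(\<Sum>e\<in>E. rest e) \<in> P 0"
      unfolding eq by (rule prime0) (auto intro: sum restR)
    then have "(\<Sum>e\<in>E. rest e) \<in> P (Suc 0)" using Suc.prems(2)[of 0] by auto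
    \<comment> \<open>Subtracting the higher terms inside \<open>P (Suc 0)\<close> leaves exactly
      the sum that the induction hypothesis excludes from it.\<close>
    then have "(\<Sum>e\<in>E. rest e) + h (- 1) * (\<Sum>e\<in>{e\<in>E. hd e \<noteq> k}. rest e) \<in> P (Suc 0)"
      using high by (intro add1 mult1 h)
    then show False using IH by (simp add: split low h.hom_uminus)
  qed
qed

section \<open>Polynomial functions and dependence by counting monomials\<close>

definition fscale :: "'k::field \<Rightarrow> ('b \<Rightarrow> 'k) \<Rightarrow> 'b \<Rightarrow> 'k" where
  "fscale c f = (\<lambda>q. c * f q)"

interpretation fun_space: vector_space "fscale :: 'k::field \<Rightarrow> ('b \<Rightarrow> 'k) \<Rightarrow> _"
  by standard (auto simp: fscale_def fun_eq_iff algebra_simps)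

text \<open>Each exponent is bounded separately, not the total degree; this makes the count
  \<open>Suc d ^ card V\<close> immediate and the bounds additive under products.\<close>

definition monom_funs :: "'v set \<Rightarrow> nat \<Rightarrow> (('v \<Rightarrow> 'k::field) \<Rightarrow> 'k) set" where
  "monom_funs V d = (\<lambda>m q. \<Prod>v\<in>V. q v ^ m v) ` (V \<rightarrow>\<^sub>E {..d})"

definition poly_funs :: "'v set \<Rightarrow> nat \<Rightarrow> (('v \<Rightarrow> 'k::field) \<Rightarrow> 'k) set" where
  "poly_funs V d = fun_space.span (monom_funs V d)"

lemma card_monom_funs:
  assumes "finite V"
  shows "finite (monom_funs V d)" "card (monom_funs V d) \<le> Suc d ^ card V"
proof -
  have fin: "finite (V \<rightarrow>\<^sub>E {..d})" using assms by (intro finite_PiE) auto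
  then show "finite (monom_funs V d)" by (simp add: monom_funs_def)
  show "card (monom_funs V d) \<le> Suc d ^ card V"
    unfolding monom_funs_def using card_image_le[OF fin] assms by (simp add: card_PiE)
qed

lemma monom_funsI:
  assumes "\<And>v. v \<in> V \<Longrightarrow> m v \<le> d"
  shows "(\<lambda>q. \<Prod>v\<in>V. q v ^ m v) \<in> monom_funs V d"
  unfolding monom_funs_def
  by (rule image_eqI[of _ _ "restrict m V"]) (use assms in auto)

text \<open>By bilinearity products of monomials suffice. The span induction runs first over the
  right factor with a monomial on the left, then over the left factor.\<close>

lemma poly_funs_mult:
  assumes "f \<in> poly_funs V d" "g \<in> poly_funs V d'"
  shows "(\<lambda>q. f q * g q) \<in> poly_funs V (d + d')"
proof -
  have mon: "(\<lambda>q. a q * b q) \<in> poly_funs V (d + d')"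
    if a: "a \<in> monom_funs V d" and b: "b \<in> monom_funs V d'" for a b :: "('a \<Rightarrow> 'b) \<Rightarrow> 'b"
  proof -
    obtain m where m: "m \<in> V \<rightarrow>\<^sub>E {..d}" "a = (\<lambda>q. \<Prod>v\<in>V. q v ^ m v)"
      using a by (auto simp: monom_funs_def)
    obtain n where n: "n \<in> V \<rightarrow>\<^sub>E {..d'}" "b = (\<lambda>q. \<Prod>v\<in>V. q v ^ n v)"
      using b by (auto simp: monom_funs_def)
    have "(\<lambda>q. \<Prod>v\<in>V. q v ^ (m v + n v)) \<in> monom_funs V (d + d')"
      by (rule monom_funsI) (use m n in \<open>auto simp: PiE_iff intro!: add_mono\<close>)
    then show ?thesis
      unfolding poly_funs_def m n by (intro fun_space.span_base) (simp add: power_add prod.distrib)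
  qed
  have "(\<lambda>q. a q * g q) \<in> poly_funs V (d + d')" if a: "a \<in> monom_funs V d" for a
    using assms(2)[unfolded poly_funs_def]
  proof (induction rule: fun_space.span_induct_alt)
    case base
    show ?case using fun_space.span_zero by (simp add: poly_funs_def zero_fun_def)
  next
    case (step c b g)
    have "fscale c (\<lambda>q. a q * b q) + (\<lambda>q. a q * g q) \<in> poly_funs V (d + d')"
      using mon[OF a step(1)] step(2) unfolding poly_funs_def
      by (intro fun_space.span_add fun_space.span_scale)
    then show ?case by (simp add: fscale_def plus_fun_def algebra_simps)
  qed
  note a = this
  show ?thesis
    using assms(1)[unfolded poly_funs_def]
  proof (induction rule: fun_space.span_induct_alt)
    case base
    show ?case using fun_space.span_zero by (simp add: poly_funs_def zero_fun_def)
  next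
    case (step c b f)
    have "fscale c (\<lambda>q. b q * g q) + (\<lambda>q. f q * g q) \<in> poly_funs V (d + d')"
      using a[OF step(1)] step(2) unfolding poly_funs_def
      by (intro fun_space.span_add fun_space.span_scale)
    then show ?case by (simp add: fscale_def plus_fun_def algebra_simps)
  qed
qed

lemma poly_funs_mono: "d \<le> d' \<Longrightarrow> poly_funs V d \<subseteq> poly_funs V d'"
  unfolding poly_funs_def monom_funs_def
  by (intro fun_space.span_mono image_mono PiE_mono) auto

lemma poly_funs_const: "(\<lambda>q. c) \<in> poly_funs V d"
proof -
  have "fscale c (\<lambda>q. \<Prod>v\<in>V. q v ^ 0) \<in> poly_funs V d"
    unfolding poly_funs_def
    by (intro fun_space.span_scale fun_space.span_base monom_funsI) auto
  then show ?thesis by (simp add: fscale_def)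
qed

lemma poly_funs_var:
  assumes "finite V" "v \<in> V"
  shows "(\<lambda>q :: 'v \<Rightarrow> 'k::field. q v) \<in> poly_funs V 1"
proof -
  have "(\<lambda>q :: 'v \<Rightarrow> 'k. \<Prod>w\<in>V. q w ^ (if w = v then 1 else 0)) \<in> poly_funs V 1"
    unfolding poly_funs_def
    by (intro fun_space.span_scale fun_space.span_base monom_funsI) auto
  moreover have "(\<lambda>q :: 'v \<Rightarrow> 'k. \<Prod>w\<in>V. q w ^ (if w = v then 1 else 0)) = (\<lambda>q. q v)"
    using assms by (simp add: if_distrib[of "(^) _"] prod.delta cong: if_cong)
  ultimately show ?thesis by (simp only:)
qed

lemma poly_funs_power: "f \<in> poly_funs V d \<Longrightarrow> (\<lambda>q. f q ^ k) \<in> poly_funs V (k * d)"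
proof (induction k)
  case (Suc k)
  then show ?case using poly_funs_mult[of f V d "\<lambda>q. f q ^ k" "k * d"] by simp
qed (simp add: poly_funs_const)

lemma poly_funs_prod:
  "(\<And>i. i \<in> I \<Longrightarrow> f i \<in> poly_funs V (d i)) \<Longrightarrow> (\<lambda>q. \<Prod>i\<in>I. f i q) \<in> poly_funs V (\<Sum>i\<in>I. d i)"
proof (induction I rule: infinite_finite_induct)
  case (insert i I)
  then show ?case using poly_funs_mult[of "f i" V "d i" "\<lambda>q. \<Prod>i\<in>I. f i q" "\<Sum>i\<in>I. d i"] by simp
qed (simp_all add: poly_funs_const)

lemma poly_funs_sum:
  assumes "\<And>i. i \<in> I \<Longrightarrow> f i \<in> poly_funs V d"
  shows "(\<lambda>q. \<Sum>i\<in>I. f i q) \<in> poly_funs V d"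
proof -
  have "(\<lambda>q. \<Sum>i\<in>I. f i q) = (\<Sum>i\<in>I. f i)"
    by (induction I rule: infinite_finite_induct) (auto simp: fun_eq_iff)
  then show ?thesis
    using assms unfolding poly_funs_def by (simp add: fun_space.span_sum)
qed

lemma eval_comp_poly_funs:
  fixes \<rho> :: "('v \<Rightarrow> 'k::field) \<Rightarrow> 'w \<Rightarrow> 'k"
  assumes \<rho>: "\<And>w. (\<lambda>q. \<rho> q w) \<in> poly_funs V 1"
  shows "\<exists>d. (\<lambda>q. eval (\<rho> q) F) \<in> poly_funs V d"
proof -
  let ?deg = "\<lambda>m :: 'w \<Rightarrow>\<^sub>0 nat. \<Sum>w\<in>Poly_Mapping.keys m. Poly_Mapping.lookup m w"
  \<comment> \<open>The sum of the degrees of all monomials of \<open>F\<close> is a crude common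
    bound for each of them.\<close>
  define d where "d = (\<Sum>m\<in>Poly_Mapping.keys F. ?deg m)"
  have "(\<lambda>q. Poly_Mapping.lookup F m * monom_eval (\<rho> q) m) \<in> poly_funs V d"
    if m: "m \<in> Poly_Mapping.keys F" for m
  proof -
    have "(\<lambda>q. \<Prod>w\<in>Poly_Mapping.keys m. \<rho> q w ^ Poly_Mapping.lookup m w) \<in> poly_funs V (?deg m)"
      using poly_funs_power[OF \<rho>] by (intro poly_funs_prod) (auto simp: mult.commute)
    then have "(\<lambda>q. Poly_Mapping.lookup F m * monom_eval (\<rho> q) m) \<in> poly_funs V (0 + ?deg m)"
      unfolding monom_eval_def by (intro poly_funs_mult poly_funs_const)
    moreover have "?deg m \<le> d"
      unfolding d_def by (rule member_le_sum) (use m in auto)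
    ultimately show ?thesis using subsetD[OF poly_funs_mono] by simp
  qed
  then show ?thesis
    unfolding poly_eval_def by (intro exI[of _ d] poly_funs_sum)
qed

text \<open>The \<open>Suc m ^ n\<close> monomials in the \<open>f i\<close> with exponents at most
  \<open>m\<close> lie in a space spanned by \<open>Suc (m * d) ^ card V\<close> functions. As
  \<open>n\<close> exceeds \<open>card V\<close>, the first number is larger once \<open>m\<close>
  is large, which forces a linear relation.\<close>

lemma poly_funs_algebraically_dependent:
  fixes f :: "nat \<Rightarrow> ('v \<Rightarrow> 'k::field) \<Rightarrow> 'k"
  assumes V: "finite V" "card V < n" and f: "\<And>i. i < n \<Longrightarrow> \<exists>d. f i \<in> poly_funs V d"
  obtains E :: "nat list set" and c where "finite E" "E \<noteq> {}"
    "\<And>e. e \<in> E \<Longrightarrow> length e = n" "\<And>e. e \<in> E \<Longrightarrow> c e \<noteq> 0"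
    "\<And>q. (\<Sum>e\<in>E. c e * (\<Prod>i<n. f i q ^ (e ! i))) = 0"
proof -
  obtain df where df: "\<And>i. i < n \<Longrightarrow> f i \<in> poly_funs V (df i)" using f by metis
  define d where "d = (\<Sum>i<n. df i)"
  \<comment> \<open>This \<open>m\<close> makes the comparison exact: after bounding
    \<open>Suc (m * d)\<close> by \<open>Suc d * Suc m\<close>, the factor
    \<open>Suc d ^ card V\<close> equals \<open>m\<close>, which is less than the one extra factor
    \<open>Suc m\<close> available.\<close>
  define m where "m = Suc d ^ card V"
  define L where "L = {e :: nat list. set e \<subseteq> {..m} \<and> length e = n}"
  define \<phi> where "\<phi> e = (\<lambda>q. \<Prod>i<n. f i q ^ (e ! i))" for e :: "nat list"
  have L: "finite L" "card L = Suc m ^ n"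
    unfolding L_def by (simp_all add: finite_lists_length_eq card_lists_length_eq)
  have \<phi>: "\<phi> e \<in> poly_funs V (m * d)" if e: "e \<in> L" for e
  proof -
    have "\<phi> e \<in> poly_funs V (\<Sum>i<n. e ! i * df i)"
      unfolding \<phi>_def by (intro poly_funs_prod poly_funs_power df) simp
    moreover have "(\<Sum>i<n. e ! i * df i) \<le> (\<Sum>i<n. m * df i)"
      using e by (intro sum_mono mult_right_mono) (auto simp: L_def subset_iff)
    ultimately show ?thesis
      unfolding d_def using poly_funs_mono by (metis subsetD sum_distrib_left)
  qed
  have "Suc (m * d) ^ card V \<le> (Suc d * Suc m) ^ card V"
    by (rule power_mono) auto
  also have "\<dots> = m * Suc m ^ card V"
    by (simp only: power_mult_distrib m_def)
  also have "\<dots> < Suc m * Suc m ^ card V" by simp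
  also have "\<dots> \<le> Suc m ^ n"
    using V(2) power_increasing[of "Suc (card V)" n "Suc m"] by simp
  finally have less: "Suc (m * d) ^ card V < card L" by (simp add: L)
  show ?thesis
  proof (cases "inj_on \<phi> L")
    case True
    have "\<not> fun_space.independent (\<phi> ` L)"
    proof
      assume "fun_space.independent (\<phi> ` L)"
      then have "card (\<phi> ` L) \<le> card (monom_funs V (m * d) :: (('v \<Rightarrow> 'k) \<Rightarrow> 'k) set)"
        using fun_space.independent_span_bound[OF card_monom_funs(1)[OF V(1)]] \<phi>
        unfolding poly_funs_def by blast
      also have "\<dots> \<le> Suc (m * d) ^ card V" by (rule card_monom_funs) fact
      finally show False using less by (simp add: card_image True)
    qed
    then obtain S u where S: "S \<subseteq> \<phi> ` L" "finite S" "(\<Sum>v\<in>S. fscale (u v) v) = 0" "\<exists>v\<in>S. u v \<noteq> 0"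
      unfolding fun_space.independent_explicit_finite_subsets by blast
    \<comment> \<open>Exponent vectors with zero coefficient are dropped, since the relation must
      have only nonzero coefficients to be fed into the chain argument.\<close>
    define E where "E = {e \<in> L. \<phi> e \<in> S \<and> u (\<phi> e) \<noteq> 0}"
    have \<phi>E: "\<phi> ` E = {v \<in> S. u v \<noteq> 0}" using S(1) by (auto simp: E_def)
    show ?thesis
    proof (rule that[of E "\<lambda>e. u (\<phi> e)"])
      show "finite E" using L by (simp add: E_def)
      show "E \<noteq> {}" using \<phi>E S(4) by auto
      show "(\<Sum>e\<in>E. u (\<phi> e) * (\<Prod>i<n. f i q ^ (e ! i))) = 0" for q
      proof -
        have app: "(\<Sum>v\<in>X. fscale (u v) v) q = (\<Sum>v\<in>X. u v * v q)" for X
          by (induction X rule: infinite_finite_induct) (auto simp: fscale_def)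
        have "inj_on \<phi> E" using True by (rule inj_on_subset) (auto simp: E_def)
        then have "(\<Sum>e\<in>E. u (\<phi> e) * \<phi> e q) = (\<Sum>v\<in>\<phi> ` E. u v * v q)"
          by (simp add: sum.reindex)
        also have "\<dots> = (\<Sum>v\<in>S. u v * v q)"
          unfolding \<phi>E using S(2) by (intro sum.mono_neutral_left) auto
        also have "\<dots> = 0" using S(3) by (simp flip: app)
        finally show ?thesis by (simp add: \<phi>_def)
      qed
    qed (auto simp: E_def L_def)
  next
    case False
    \<comment> \<open>Two different monomials in the \<open>f i\<close> that coincide as functions
      already give a relation, with coefficients 1 and -1.\<close>
    then obtain a b where ab: "a \<in> L" "b \<in> L" "a \<noteq> b" "\<phi> a = \<phi> b"
      by (auto simp: inj_on_def)
    show ?thesis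
    proof (rule that[of "{a, b}" "\<lambda>e. if e = a then 1 else - 1"])
      show "(\<Sum>e\<in>{a, b}. (if e = a then 1 else - 1) * (\<Prod>i<n. f i q ^ (e ! i))) = 0" for q
        using ab(3) fun_cong[OF ab(4), of q] unfolding \<phi>_def by simp
    qed (use ab in \<open>auto simp: L_def\<close>)
  qed
qed

section \<open>The ring of invariants\<close>

lemma tpoly_carrier: "F \<in> carrier (tpoly_ring g r) \<longleftrightarrow>
    (\<forall>m\<in>Poly_Mapping.keys F. Poly_Mapping.keys m \<subseteq> tvars g r)"
  by (simp add: tpoly_ring_def)

lemma tpoly_add:
  "F \<in> carrier (tpoly_ring g r) \<Longrightarrow> G \<in> carrier (tpoly_ring g r) \<Longrightarrow> F + G \<in> carrier (tpoly_ring g r)"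
  using keys_add[of F G] unfolding tpoly_carrier by blast

lemma tpoly_mult:
  assumes "F \<in> carrier (tpoly_ring g r)" "G \<in> carrier (tpoly_ring g r)"
  shows "F * G \<in> carrier (tpoly_ring g r)"
  unfolding tpoly_carrier
proof
  fix m assume "m \<in> Poly_Mapping.keys (F * G)"
  then obtain a b where "m = a + b" "a \<in> Poly_Mapping.keys F" "b \<in> Poly_Mapping.keys G"
    using keys_mult[of F G] by blast
  then show "Poly_Mapping.keys m \<subseteq> tvars g r"
    using assms keys_add[of a b] unfolding tpoly_carrier by blast
qed

lemma tpoly_tconst [simp]: "tconst c \<in> carrier (tpoly_ring g r)"
  by (simp add: tpoly_carrier tconst_def)

lemma tconst_0 [simp]: "tconst 0 = 0"
  and tconst_1 [simp]: "tconst 1 = 1"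
  by (simp_all add: tconst_def)

lemma tpoly_0 [simp]: "0 \<in> carrier (tpoly_ring g r)"
  and tpoly_1 [simp]: "1 \<in> carrier (tpoly_ring g r)"
  using tpoly_tconst[of 0] tpoly_tconst[of 1] by (simp_all del: tpoly_tconst)

lemma tpoly_tvar: "v \<in> tvars g r \<Longrightarrow> tvar v \<in> carrier (tpoly_ring g r)"
  by (simp add: tpoly_carrier tvar_def)

lemma tpoly_uminus: "F \<in> carrier (tpoly_ring g r) \<Longrightarrow> - F \<in> carrier (tpoly_ring g r)"
  by (simp add: tpoly_carrier in_keys_iff)

lemma tpoly_diff:
  "F \<in> carrier (tpoly_ring g r) \<Longrightarrow> G \<in> carrier (tpoly_ring g r) \<Longrightarrow> F - G \<in> carrier (tpoly_ring g r)"
  using tpoly_add[of F g r "- G"] tpoly_uminus[of G g r] by simp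

lemma tpoly_sum:
  "(\<And>i. i \<in> I \<Longrightarrow> f i \<in> carrier (tpoly_ring g r)) \<Longrightarrow> (\<Sum>i\<in>I. f i) \<in> carrier (tpoly_ring g r)"
  by (induction I rule: infinite_finite_induct) (auto intro: tpoly_add)

lemma tpoly_prod:
  "(\<And>i. i \<in> I \<Longrightarrow> f i \<in> carrier (tpoly_ring g r)) \<Longrightarrow> (\<Prod>i\<in>I. f i) \<in> carrier (tpoly_ring g r)"
  by (induction I rule: infinite_finite_induct) (auto intro: tpoly_mult)

lemma eval_cong_tvars:
  assumes "F \<in> carrier (tpoly_ring g r)" "\<And>v. v \<in> tvars g r \<Longrightarrow> \<sigma> v = \<tau> v"
  shows "eval \<sigma> F = eval \<tau> F"
  unfolding poly_eval_def
  by (intro sum.cong refl arg_cong2[of _ _ _ _ "(*)"] monom_eval_cong)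
     (metis assms subsetD tpoly_carrier)

text \<open>The type of polynomials has infinitely many indeterminates, so it must be tracked
  entrywise that determinants and adjugates stay in the ring for \<open>g\<close> and
  \<open>r\<close>. The size \<open>n\<close> is separate from \<open>g\<close> because cofactors
  have smaller size.\<close>

definition tpoly_mats :: "nat \<Rightarrow> nat \<Rightarrow> nat \<Rightarrow> 'k::field tpoly mat set" where
  "tpoly_mats g r n = {A \<in> carrier_mat n n. \<forall>i<n. \<forall>j<n. A $$ (i, j) \<in> carrier (tpoly_ring g r)}"

lemma tpoly_mats_det:
  assumes "A \<in> tpoly_mats g r n"
  shows "det A \<in> carrier (tpoly_ring g r)"
proof -
  have A: "A \<in> carrier_mat n n" using assms by (simp add: tpoly_mats_def)
  have sg: "signof p \<in> carrier (tpoly_ring g r)" for p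
    by (cases p rule: sign_cases) (auto intro: tpoly_uminus)
  have "p i < n" if "p permutes {0..<n}" "i < n" for p i
    using permutes_in_image[OF that(1), of i] that(2) by simp
  then show ?thesis
    unfolding det_def'[OF A] using assms
    by (intro tpoly_sum tpoly_mult tpoly_prod sg) (auto simp: tpoly_mats_def)
qed

lemma tpoly_mats_mult:
  "A \<in> tpoly_mats g r n \<Longrightarrow> B \<in> tpoly_mats g r n \<Longrightarrow> A * B \<in> tpoly_mats g r n"
  by (auto simp: tpoly_mats_def scalar_prod_def intro!: tpoly_sum tpoly_mult)

lemma tpoly_mats_adj:
  assumes "A \<in> tpoly_mats g r n"
  shows "adj_mat A \<in> tpoly_mats g r n"
proof -
  have A: "A \<in> carrier_mat n n" using assms by (simp add: tpoly_mats_def)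
  have del: "mat_delete A i j \<in> tpoly_mats g r (n - 1)" if "i < n" "j < n" for i j
    using assms that by (auto simp: tpoly_mats_def mat_delete_def)
  have sg: "(- 1) ^ k \<in> carrier (tpoly_ring g r)" for k :: nat
    by (cases "even k") (auto intro: tpoly_uminus)
  show ?thesis
    using A by (auto simp: tpoly_mats_def adj_mat_def cofactor_def intro!: tpoly_mult sg tpoly_mats_det del)
qed

lemma generic_sym_mat_tpoly_mats: "l \<le> r \<Longrightarrow> generic_sym_mat g l \<in> tpoly_mats g r g"
  by (auto simp: tpoly_mats_def generic_sym_mat_def tvars_def intro!: tpoly_tvar)

section \<open>The action on points and invariance\<close>

definition sym_mat :: "nat \<Rightarrow> (tvar \<Rightarrow> 'k::field) \<Rightarrow> nat \<Rightarrow> 'k mat" where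
  "sym_mat g p l = mat g g (\<lambda>(i, j). p (l, min i j, max i j))"

text \<open>This is the action on tuples of matrices by \<open>L\<close> itself; acting on
  polynomials by \<open>\<Lambda>\<close> is pulling back along this map for the inverse of
  \<open>\<Lambda>\<close>. Values at positions outside \<open>tvars\<close> never matter for
  polynomials of the ring.\<close>

definition sym_act :: "nat \<Rightarrow> 'k::field mat \<Rightarrow> (tvar \<Rightarrow> 'k) \<Rightarrow> tvar \<Rightarrow> 'k" where
  "sym_act g L p = (\<lambda>(l, i, j). (L * sym_mat g p l * transpose_mat L) $$ (i, j))"

lemma sym_mat_carrier [simp]: "sym_mat g p l \<in> carrier_mat g g"
  by (simp add: sym_mat_def)

lemma sym_mat_dim [simp]: "dim_row (sym_mat g p l) = g" "dim_col (sym_mat g p l) = g"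
  by (simp_all add: sym_mat_def)

lemma sym_mat_index: "i < g \<Longrightarrow> j < g \<Longrightarrow> sym_mat g p l $$ (i, j) = p (l, min i j, max i j)"
  by (simp add: sym_mat_def)

lemma transpose_sym_mat [simp]: "transpose_mat (sym_mat g p l) = sym_mat g p l"
  by (rule eq_matI) (auto simp: sym_mat_def min.commute max.commute)

text \<open>\<open>sym_mat\<close> rebuilds a matrix from its upper triangle, so the identity rests
  on congruence preserving symmetry.\<close>

lemma sym_mat_act:
  assumes L: "L \<in> carrier_mat g g"
  shows "sym_mat g (sym_act g L p) l = L * sym_mat g p l * transpose_mat L"
proof (rule eq_matI)
  let ?N = "L * sym_mat g p l * transpose_mat L"
  have "transpose_mat ?N = L * (sym_mat g p l * transpose_mat L)"
    using L by (simp add: transpose_mult[of _ g g _ g])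
  also have "\<dots> = ?N"
    using L by (simp add: assoc_mult_mat[of _ g g _ g _ g])
  finally have tr: "transpose_mat ?N = ?N" .
  have sym: "?N $$ (i, j) = ?N $$ (j, i)" if "i < g" "j < g" for i j
  proof -
    have "transpose_mat ?N $$ (j, i) = ?N $$ (i, j)"
      using that L by (intro index_transpose_mat(1)) auto
    then show ?thesis by (simp only: tr)
  qed
  fix i j assume "i < dim_row ?N" "j < dim_col ?N"
  then have ij: "i < g" "j < g" using L by auto
  have "sym_mat g (sym_act g L p) l $$ (i, j) = ?N $$ (min i j, max i j)"
    using ij by (simp only: sym_mat_index sym_act_def prod.case)
  also have "\<dots> = ?N $$ (i, j)"
    using sym[OF ij] by (cases "i \<le> j") (simp_all only: min_def max_def if_True if_False)
  finally show "sym_mat g (sym_act g L p) l $$ (i, j) = ?N $$ (i, j)" .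
qed (use L in auto)

lemma map_eval_generic_sym_mat: "map_mat (eval p) (generic_sym_mat g l) = sym_mat g p l"
  by (rule eq_matI) (auto simp: generic_sym_mat_def sym_mat_def)

lemma adj_mat_inverse:
  fixes L :: "'k::comm_ring_1 mat"
  assumes L: "L \<in> carrier_mat n n" "det L = 1"
  shows "adj_mat L \<in> carrier_mat n n" "adj_mat L * L = 1\<^sub>m n" "L * adj_mat L = 1\<^sub>m n" "det (adj_mat L) = 1"
proof -
  show a: "adj_mat L \<in> carrier_mat n n" "adj_mat L * L = 1\<^sub>m n" "L * adj_mat L = 1\<^sub>m n"
    using adj_mat[OF L(1)] L(2) by auto
  have "det (adj_mat L * L) = det (adj_mat L) * det L" using a L by (intro det_mult) auto
  then show "det (adj_mat L) = 1" using a L by simp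
qed

lemma group_SL: "group (SL g)"
proof (rule groupI)
  fix x :: "'a mat" assume "x \<in> carrier (SL g)"
  then show "\<exists>y\<in>carrier (SL g). y \<otimes>\<^bsub>SL g\<^esub> x = \<one>\<^bsub>SL g\<^esub>"
    using adj_mat_inverse[of x g] by (auto simp: SL_def)
qed (auto simp: SL_def det_mult[of _ g] assoc_mult_mat[of _ g g _ g _ g])

text \<open>The bridge from formal substitution to points: it turns every question about invariance
  into a matrix identity at a point.\<close>

lemma eval_SL_act:
  assumes \<Lambda>: "\<Lambda> \<in> carrier (SL g)" and F: "F \<in> carrier (tpoly_ring g r)"
  shows "eval p (SL_act g \<Lambda> F) = eval (sym_act g (inv\<^bsub>SL g\<^esub> \<Lambda>) p) F"
proof -
  interpret SL: group "SL g" by (rule group_SL)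
  let ?L = "inv\<^bsub>SL g\<^esub> \<Lambda>" and ?M = "map_mat tconst (inv\<^bsub>SL g\<^esub> \<Lambda>)"
  have L: "?L \<in> carrier_mat g g" using SL.inv_closed[OF \<Lambda>] by (simp add: SL_def)
  have G: "generic_sym_mat g l \<in> carrier_mat g g" for l
    by (simp add: generic_sym_mat_def)
  have M: "map_mat (eval p) ?M = ?L" by (rule eq_matI) auto
  have MT: "map_mat (eval p) (transpose_mat ?M) = transpose_mat ?L" by (rule eq_matI) auto
  have *: "map_mat (eval p) (?M * generic_sym_mat g l * transpose_mat ?M) = ?L * sym_mat g p l * transpose_mat ?L" for l
  proof -
    have "?M \<in> carrier_mat g g" "transpose_mat ?M \<in> carrier_mat g g" using L by auto
    then show ?thesis
      by (simp only: eval.mat_hom_mult[OF mult_carrier_mat[OF _ G]] eval.mat_hom_mult[OF _ G]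
          M MT map_eval_generic_sym_mat)
  qed
  have "eval p (SL_act g \<Lambda> F)
      = eval (\<lambda>v. eval p (case v of (l, i, j) \<Rightarrow> (?M * generic_sym_mat g l * transpose_mat ?M) $$ (i, j))) F"
    by (simp add: SL_act_def Let_def eval_tsubst)
  also have "\<dots> = eval (sym_act g ?L p) F"
  proof (rule eval_cong_tvars[OF F])
    fix v assume "v \<in> tvars g r"
    then obtain l i j where v: "v = (l, i, j)" "i < g" "j < g" by (auto simp: tvars_def)
    have "eval p ((?M * generic_sym_mat g l * transpose_mat ?M) $$ (i, j))
        = map_mat (eval p) (?M * generic_sym_mat g l * transpose_mat ?M) $$ (i, j)"
      using v L G[of l] by simp
    then show "eval p (case v of (l, i, j) \<Rightarrow> (?M * generic_sym_mat g l * transpose_mat ?M) $$ (i, j))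
        = sym_act g ?L p v"
      unfolding * by (simp add: v sym_act_def)
  qed
  finally show ?thesis .
qed

lemma invariantD:
  assumes "F \<in> carrier (SL_invariant_ring g r)" "L \<in> carrier_mat g g" "det L = 1"
  shows "eval (sym_act g L p) F = eval p F"
proof -
  interpret SL: group "SL g" by (rule group_SL)
  have L: "L \<in> carrier (SL g)" using assms by (simp add: SL_def)
  \<comment> \<open>Invariance is applied to the inverse of \<open>L\<close>, because
    \<open>SL_act\<close> inverts its matrix once more.\<close>
  have F: "F \<in> carrier (tpoly_ring g r)" "SL_act g (inv\<^bsub>SL g\<^esub> L) F = F"
    using assms(1) SL.inv_closed[OF L] by (auto simp: SL_invariant_ring_def)
  show ?thesis using eval_SL_act[OF SL.inv_closed[OF L] F(1), of p] L F(2) by simp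
qed

text \<open>A pointwise check is enough, since over an infinite field a polynomial is determined by
  its values.\<close>

lemma invariantI:
  fixes F :: "'k::alg_closed_field tpoly"
  assumes F: "F \<in> carrier (tpoly_ring g r)"
    and inv: "\<And>L p. L \<in> carrier_mat g g \<Longrightarrow> det L = 1 \<Longrightarrow> eval (sym_act g L p) F = eval p F"
  shows "F \<in> carrier (SL_invariant_ring g r)"
proof -
  interpret SL: group "SL g" by (rule group_SL)
  have "SL_act g \<Lambda> F = F" if \<Lambda>: "\<Lambda> \<in> carrier (SL g)" for \<Lambda>
  proof (rule eval_eqI)
    have "inv\<^bsub>SL g\<^esub> \<Lambda> \<in> carrier_mat g g \<and> det (inv\<^bsub>SL g\<^esub> \<Lambda>) = 1"
      using SL.inv_closed[OF \<Lambda>] by (simp add: SL_def)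
    then show "eval \<sigma> (SL_act g \<Lambda> F) = eval \<sigma> F" for \<sigma>
      by (simp add: eval_SL_act[OF \<Lambda> F] inv)
  qed
  then show ?thesis using F by (simp add: SL_invariant_ring_def)
qed

text \<open>The locus \<open>D \<noteq> 0\<close> is dense: the difference of both sides times
  \<open>D\<close> vanishes at every point, and affine space is irreducible. This serves invariants
  whose transformation law is obtained by dividing by determinants.\<close>

lemma invariantI_generic:
  fixes F D :: "'k::alg_closed_field tpoly"
  assumes F: "F \<in> carrier (tpoly_ring g r)" and D: "eval p0 D \<noteq> 0"
    and inv: "\<And>L p. L \<in> carrier_mat g g \<Longrightarrow> det L = 1 \<Longrightarrow> eval p D \<noteq> 0 \<Longrightarrow> eval (sym_act g L p) F = eval p F"
  shows "F \<in> carrier (SL_invariant_ring g r)"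
proof -
  interpret SL: group "SL g" by (rule group_SL)
  have "SL_act g \<Lambda> F = F" if \<Lambda>: "\<Lambda> \<in> carrier (SL g)" for \<Lambda>
  proof -
    have L: "inv\<^bsub>SL g\<^esub> \<Lambda> \<in> carrier_mat g g" "det (inv\<^bsub>SL g\<^esub> \<Lambda>) = 1"
      using SL.inv_closed[OF \<Lambda>] by (simp_all add: SL_def)
    have "eval p (SL_act g \<Lambda> F - F) = 0" for p
    proof (rule eval_irreducible[of UNIV _ D p0])
      show "eval p ((SL_act g \<Lambda> F - F) * D) = 0" for p
        using inv[OF L, of p] by (cases "eval p D = 0") (simp_all add: eval.hom_mult eval.hom_minus eval_SL_act[OF \<Lambda> F])
    qed (use D in auto)
    then have "SL_act g \<Lambda> F - F = 0" by (rule eval_eq_0_imp_eq_0)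
    then show ?thesis by simp
  qed
  then show ?thesis using F by (simp add: SL_invariant_ring_def)
qed

section \<open>The commutative ring of invariants and its primes of vanishing\<close>

lemma SL_invariant_ring_simps [simp]:
  "monoid.mult (SL_invariant_ring g r) = (*)" "ring.add (SL_invariant_ring g r) = (+)"
  "ring.zero (SL_invariant_ring g r) = 0" "monoid.one (SL_invariant_ring g r) = 1"
  by (simp_all add: SL_invariant_ring_def tpoly_ring_def)

lemma invariant_tpoly: "F \<in> carrier (SL_invariant_ring g r) \<Longrightarrow> F \<in> carrier (tpoly_ring g r)"
  by (simp add: SL_invariant_ring_def)

lemma invariant_add:
  fixes F G :: "'k::alg_closed_field tpoly"
  assumes "F \<in> carrier (SL_invariant_ring g r)" "G \<in> carrier (SL_invariant_ring g r)"
  shows "F + G \<in> carrier (SL_invariant_ring g r)"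
  using assms by (intro invariantI tpoly_add) (auto simp: eval.hom_add invariantD invariant_tpoly)

lemma invariant_mult:
  fixes F G :: "'k::alg_closed_field tpoly"
  assumes "F \<in> carrier (SL_invariant_ring g r)" "G \<in> carrier (SL_invariant_ring g r)"
  shows "F * G \<in> carrier (SL_invariant_ring g r)"
  using assms by (intro invariantI tpoly_mult) (auto simp: eval.hom_mult invariantD invariant_tpoly)

lemma invariant_tconst: "tconst (c :: 'k::alg_closed_field) \<in> carrier (SL_invariant_ring g r)"
  by (intro invariantI) auto

lemma invariant_0: "(0 :: 'k::alg_closed_field tpoly) \<in> carrier (SL_invariant_ring g r)"
  and invariant_1: "(1 :: 'k tpoly) \<in> carrier (SL_invariant_ring g r)"
  using invariant_tconst[of 0] invariant_tconst[of 1] by simp_all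

lemma invariant_uminus:
  fixes F :: "'k::alg_closed_field tpoly"
  assumes "F \<in> carrier (SL_invariant_ring g r)"
  shows "- F \<in> carrier (SL_invariant_ring g r)"
  using assms by (intro invariantI tpoly_uminus) (auto simp: eval.hom_uminus invariantD invariant_tpoly)

lemma cring_SL_invariant_ring: "cring (SL_invariant_ring g r :: 'k::alg_closed_field tpoly ring)"
proof (rule cringI)
  show "abelian_group (SL_invariant_ring g r :: 'k tpoly ring)"
  proof (rule abelian_groupI)
    fix x :: "'k tpoly" assume "x \<in> carrier (SL_invariant_ring g r)"
    then show "\<exists>y\<in>carrier (SL_invariant_ring g r). y \<oplus>\<^bsub>SL_invariant_ring g r\<^esub> x = \<zero>\<^bsub>SL_invariant_ring g r\<^esub>"
      by (intro bexI[of _ "- x"]) (auto intro: invariant_uminus)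
  qed (auto simp: add_ac intro: invariant_add invariant_0)
  show "Group.comm_monoid (SL_invariant_ring g r :: 'k tpoly ring)"
    by (rule comm_monoidI) (auto simp: mult_ac intro: invariant_mult invariant_1)
qed (auto simp: distrib_right)

text \<open>Primality is the irreducibility of \<open>W\<close>, obtained from lines inside
  \<open>W\<close>; a single point of \<open>W\<close> shows that 1 is not in the ideal.\<close>

lemma primeideal_vanishing:
  fixes W :: "(tvar \<Rightarrow> 'k::alg_closed_field) set"
  assumes ne: "W \<noteq> {}"
    and aff: "\<And>\<sigma> \<tau> t. \<sigma> \<in> W \<Longrightarrow> \<tau> \<in> W \<Longrightarrow> (\<lambda>v. \<sigma> v + t * (\<tau> v - \<sigma> v)) \<in> W"
  shows "primeideal {F \<in> carrier (SL_invariant_ring g r). \<forall>\<sigma>\<in>W. eval \<sigma> F = 0} (SL_invariant_ring g r)"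
    (is "primeideal ?P ?R")
proof (rule primeidealI)
  interpret cring ?R by (rule cring_SL_invariant_ring)
  show "ideal ?P ?R"
  proof (rule idealI)
    show "ring ?R" by (rule ring_axioms)
    show "subgroup ?P (add_monoid ?R)"
    proof (rule group.subgroupI)
      show "Group.group (add_monoid ?R)" by (rule a_group)
      fix F assume F: "F \<in> ?P"
      have "\<ominus>\<^bsub>?R\<^esub> F = - F"
        using F by (intro minus_equality) (auto intro: invariant_uminus)
      then show "inv\<^bsub>add_monoid ?R\<^esub> F \<in> ?P"
        using F by (simp add: a_inv_def invariant_uminus eval.hom_uminus)
    qed (auto intro: invariant_add invariant_0 simp: eval.hom_add)
  qed (auto intro: invariant_mult simp: eval.hom_mult)
  show "cring ?R" by (rule cring_SL_invariant_ring)
  have "1 \<in> carrier ?R" "1 \<notin> ?P" using ne invariant_1 by auto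
  then show "carrier ?R \<noteq> ?P" by blast
  fix F G assume FG: "F \<in> carrier ?R" "G \<in> carrier ?R" "F \<otimes>\<^bsub>?R\<^esub> G \<in> ?P"
  show "F \<in> ?P \<or> G \<in> ?P"
  proof (rule disjCI)
    assume "G \<notin> ?P"
    then obtain \<tau> where \<tau>: "\<tau> \<in> W" "eval \<tau> G \<noteq> 0" using FG by auto
    have "eval \<sigma> F = 0" if \<sigma>: "\<sigma> \<in> W" for \<sigma>
      by (rule eval_irreducible[where W = W and G = G and \<tau> = \<tau>, OF aff _ \<tau> \<sigma>]) (use FG(3) in auto)
    then show "F \<in> ?P" using FG by simp
  qed
qed

section \<open>Congruence and simultaneous diagonalisation\<close>

definition mat_tr :: "'a::comm_ring_1 mat \<Rightarrow> 'a" where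
  "mat_tr A = (\<Sum>i<dim_row A. A $$ (i, i))"

lemma mat_tr_comm:
  assumes "A \<in> carrier_mat n n" "B \<in> carrier_mat n n"
  shows "mat_tr (A * B) = mat_tr (B * A)"
proof -
  have "mat_tr (A * B) = (\<Sum>i<n. \<Sum>j<n. A $$ (i, j) * B $$ (j, i))"
    using assms by (auto simp: mat_tr_def scalar_prod_def atLeast0LessThan intro!: sum.cong)
  also have "\<dots> = (\<Sum>j<n. \<Sum>i<n. B $$ (j, i) * A $$ (i, j))"
    by (subst sum.swap) (simp add: mult.commute)
  also have "\<dots> = mat_tr (B * A)"
    using assms by (auto simp: mat_tr_def scalar_prod_def atLeast0LessThan intro!: sum.cong)
  finally show ?thesis .
qed

lemma (in comm_ring_hom) adj_mat_hom: "map_mat hom (adj_mat A) = adj_mat (map_mat hom A)"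
proof (rule eq_matI)
  have del: "map_mat hom (mat_delete A i j) = mat_delete (map_mat hom A) i j" for i j
    by (auto simp: mat_delete_def intro!: eq_matI)
  fix i j assume "i < dim_row (adj_mat (map_mat hom A))" "j < dim_col (adj_mat (map_mat hom A))"
  then have ij: "i < dim_row A" "j < dim_col A" by (auto simp: adj_mat_def)
  then show "map_mat hom (adj_mat A) $$ (i, j) = adj_mat (map_mat hom A) $$ (i, j)"
    by (simp add: adj_mat_def cofactor_def hom_mult hom_power hom_uminus del[symmetric])
qed (auto simp: adj_mat_def)

text \<open>Multiplying \<open>L * Y * transpose_mat L\<close> by the claimed adjugate gives
  \<open>det Y\<close> times the identity. Applying the true adjugate on the left and cancelling
  \<open>det Y\<close> identifies the two.\<close>

lemma adj_mat_congruence: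
  fixes L Y :: "'k::field mat"
  assumes L: "L \<in> carrier_mat n n" "det L = 1" and Y: "Y \<in> carrier_mat n n" "det Y \<noteq> 0"
  shows "adj_mat (L * Y * transpose_mat L) = transpose_mat (adj_mat L) * adj_mat Y * adj_mat L"
proof -
  note assoc = assoc_mult_mat[of _ n n _ n _ n]
  let ?Z = "L * Y * transpose_mat L" and ?X = "transpose_mat (adj_mat L) * adj_mat Y * adj_mat L"
  note L' = adj_mat_inverse[OF L]
  have Y': "adj_mat Y \<in> carrier_mat n n" using adj_mat[OF Y(1)] by simp
  have Z: "?Z \<in> carrier_mat n n" using L Y by auto
  have Z': "adj_mat ?Z \<in> carrier_mat n n" using adj_mat[OF Z] by simp
  have X: "?X \<in> carrier_mat n n" using L' Y' by auto
  have detZ: "det ?Z = det Y" using L Y by (simp add: det_mult[of _ n] det_transpose[of _ n])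
  have LL: "transpose_mat L * transpose_mat (adj_mat L) = 1\<^sub>m n"
    using L L' by (simp flip: transpose_mult[of _ n n _ n])
  have "?Z * ?X = L * Y * (transpose_mat L * transpose_mat (adj_mat L)) * (adj_mat Y * adj_mat L)"
    using L Y L' Y' by (simp add: assoc)
  also have "\<dots> = L * (Y * adj_mat Y) * adj_mat L"
    using L Y L' Y' by (simp add: LL) (simp add: assoc)
  also have "\<dots> = det Y \<cdot>\<^sub>m 1\<^sub>m n"
    using L L' by (simp add: adj_mat[OF Y(1)] mult_smult_distrib[of L n n "1\<^sub>m n" n] mult_smult_assoc_mat[of L n n "adj_mat L" n])
  finally have ZX: "?Z * ?X = det Y \<cdot>\<^sub>m 1\<^sub>m n" .
  have "adj_mat ?Z * (?Z * ?X) = (adj_mat ?Z * ?Z) * ?X"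
    using Z Z' X by (intro assoc[symmetric])
  then have "det Y \<cdot>\<^sub>m adj_mat ?Z = det Y \<cdot>\<^sub>m ?X"
    unfolding ZX adj_mat(3)[OF Z] detZ using Z' X
    by (simp add: mult_smult_distrib[of _ n n "1\<^sub>m n" n] mult_smult_assoc_mat[of "1\<^sub>m n" n n _ n]
        left_mult_one_mat[OF X])
  moreover have "A = B"
    if c: "c \<cdot>\<^sub>m A = c \<cdot>\<^sub>m B" "c \<noteq> 0" and AB: "A \<in> carrier_mat n n" "B \<in> carrier_mat n n"
    for A B :: "'k mat" and c
  proof (rule eq_matI)
    fix i j assume ij: "i < dim_row B" "j < dim_col B"
    have "(c \<cdot>\<^sub>m A) $$ (i, j) = (c \<cdot>\<^sub>m B) $$ (i, j)" by (simp only: c(1))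
    then show "A $$ (i, j) = B $$ (i, j)" using ij AB c(2) by simp
  qed (use AB in auto)
  ultimately show ?thesis using Y(2) Z' X by blast
qed

text \<open>Each product of an adjugate with \<open>X\<close> changes by conjugation with the
  inverse transpose of \<open>L\<close>, so the trace of the product of two of them is
  unchanged.\<close>

lemma mat_tr_adj_congruence:
  fixes L Y :: "'k::field mat"
  assumes L: "L \<in> carrier_mat n n" "det L = 1"
    and Y: "Y \<in> carrier_mat n n" "det Y \<noteq> 0" and Z: "Z \<in> carrier_mat n n" "det Z \<noteq> 0"
    and X: "X \<in> carrier_mat n n"
  shows "mat_tr (adj_mat (L * Y * transpose_mat L) * (L * X * transpose_mat L) *
            (adj_mat (L * Z * transpose_mat L) * (L * X * transpose_mat L)))
       = mat_tr (adj_mat Y * X * (adj_mat Z * X))"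
proof -
  note assoc = assoc_mult_mat[of _ n n _ n _ n]
  note L' = adj_mat_inverse[OF L]
  have YZ': "adj_mat Y \<in> carrier_mat n n" "adj_mat Z \<in> carrier_mat n n"
    using adj_mat[OF Y(1)] adj_mat[OF Z(1)] by simp_all
  have LL: "transpose_mat L * transpose_mat (adj_mat L) = 1\<^sub>m n"
    using L L' by (simp flip: transpose_mult[of _ n n _ n])
  have conj: "adj_mat (L * S * transpose_mat L) * (L * X * transpose_mat L)
      = transpose_mat (adj_mat L) * ((adj_mat S * X) * transpose_mat L)"
    if S: "S \<in> carrier_mat n n" "det S \<noteq> 0" for S
  proof -
    have S': "adj_mat S \<in> carrier_mat n n" using adj_mat[OF S(1)] by simp
    have "adj_mat (L * S * transpose_mat L) * (L * X * transpose_mat L)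
      = transpose_mat (adj_mat L) * adj_mat S * (adj_mat L * L) * (X * transpose_mat L)"
      unfolding adj_mat_congruence[OF L S] using L(1) L'(1) S' X by (simp add: assoc)
    also have "\<dots> = transpose_mat (adj_mat L) * adj_mat S * (X * transpose_mat L)"
      unfolding L'(2) using L' S' by (simp add: right_mult_one_mat[of _ n n])
    also have "\<dots> = transpose_mat (adj_mat L) * ((adj_mat S * X) * transpose_mat L)"
      using L L' S' X by (simp add: assoc)
    finally show ?thesis .
  qed
  define K K' where "K = adj_mat Y * X" and "K' = adj_mat Z * X"
  have K: "K \<in> carrier_mat n n" "K' \<in> carrier_mat n n" using YZ' X by (auto simp: K_def K'_def)
  have "transpose_mat (adj_mat L) * (K * transpose_mat L) * (transpose_mat (adj_mat L) * (K' * transpose_mat L))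
      = transpose_mat (adj_mat L) * (K * ((transpose_mat L * transpose_mat (adj_mat L)) * (K' * transpose_mat L)))"
    using K L L' by (simp add: assoc)
  also have "\<dots> = transpose_mat (adj_mat L) * ((K * K') * transpose_mat L)"
    unfolding LL using K L L' by (simp add: assoc)
  finally have "mat_tr (adj_mat (L * Y * transpose_mat L) * (L * X * transpose_mat L) *
            (adj_mat (L * Z * transpose_mat L) * (L * X * transpose_mat L)))
      = mat_tr (transpose_mat (adj_mat L) * ((K * K') * transpose_mat L))"
    by (simp only: conj[OF Y] conj[OF Z] K_def K'_def)
  also have "\<dots> = mat_tr ((K * K') * transpose_mat L * transpose_mat (adj_mat L))"
    using K L L' by (intro mat_tr_comm[of _ n]) auto
  also have "(K * K') * transpose_mat L * transpose_mat (adj_mat L) = (K * K') * (transpose_mat L * transpose_mat (adj_mat L))"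
    using K L L' by (intro assoc) auto
  also have "\<dots> = K * K'" unfolding LL using K by auto
  finally show ?thesis by (simp only: K_def K'_def)
qed

section \<open>Diagonal matrices and the derivative of the characteristic polynomial\<close>

abbreviation diag_of :: "nat \<Rightarrow> (nat \<Rightarrow> 'a::zero) \<Rightarrow> 'a mat" where
  "diag_of n d \<equiv> mat n n (\<lambda>(i, j). if i = j then d i else 0)"

lemma det_diag_of: "det (diag_of n d) = (\<Prod>i<n. d i :: 'a::comm_ring_1)"
  by (subst det_upper_triangular[of _ n])
     (auto simp: upper_triangular_def prod_list_diag_prod atLeast0LessThan intro!: prod.cong)

text \<open>
  This is \<open>p'(M)\<close> for the characteristic polynomial \<open>p\<close> of \<open>M\<close>; over a field, its determinant is
  nonzero iff all eigenvalues of \<open>M\<close> are simple, which replaces the discriminant. The coefficients of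
  \<open>p'\<close> are written out because \<^const>\<open>pderiv\<close> is not available over rings with zero divisors.
\<close>

definition char_deriv_mat :: "'a::comm_ring_1 mat \<Rightarrow> 'a mat" where
  "char_deriv_mat M = mat (dim_row M) (dim_row M)
     (\<lambda>(i, j). \<Sum>k<dim_row M. of_nat (Suc k) * coeff (char_poly M) (Suc k) * (M ^\<^sub>m k) $$ (i, j))"

lemma char_deriv_mat_carrier [simp]:
  "M \<in> carrier_mat n n \<Longrightarrow> char_deriv_mat M \<in> carrier_mat n n"
  by (simp add: char_deriv_mat_def)

lemma (in comm_ring_hom) char_deriv_mat_hom:
  assumes M: "M \<in> carrier_mat n n"
  shows "char_deriv_mat (map_mat hom M) = map_mat hom (char_deriv_mat M)"
proof (rule eq_matI)
  fix i j assume "i < dim_row (map_mat hom (char_deriv_mat M))" "j < dim_col (map_mat hom (char_deriv_mat M))"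
  then have ij: "i < n" "j < n" using M by (auto simp: char_deriv_mat_def)
  have pow: "(map_mat hom M ^\<^sub>m k) $$ (i, j) = hom ((M ^\<^sub>m k) $$ (i, j))" for k
    using ij M pow_carrier_mat[OF M, of k] by (simp flip: mat_hom_pow[OF M])
  show "char_deriv_mat (map_mat hom M) $$ (i, j) = map_mat hom (char_deriv_mat M) $$ (i, j)"
    using ij M
    by (simp add: char_deriv_mat_def char_poly_hom[OF M] pow coeff_map_poly hom_sum
        hom_mult hom_distribs)
qed (auto simp: char_deriv_mat_def)

lemma char_deriv_mat_eigenvector:
  fixes M :: "'a::field mat"
  assumes M: "M \<in> carrier_mat n n" and v: "eigenvector M v k" and n: "n > 0"
  shows "char_deriv_mat M *\<^sub>v v = poly (pderiv (char_poly M)) k \<cdot>\<^sub>v v"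
proof (rule eq_vecI)
  have vc: "v \<in> carrier_vec n" using v M by (simp add: eigenvector_def)
  let ?p = "pderiv (char_poly M)"
  \<comment> \<open>This bound, which uses \<open>n > 0\<close>, shows that the sum over
    \<open>k < n\<close> in \<open>char_deriv_mat\<close> catches every coefficient of the
    derivative.\<close>
  have deg: "degree ?p < n"
  proof -
    have "degree ?p \<le> degree (char_poly M) - 1" by (rule degree_pderiv_le)
    then show ?thesis using degree_monic_char_poly[OF M] n by linarith
  qed
  fix i assume "i < dim_vec (poly ?p k \<cdot>\<^sub>v v)"
  then have i: "i < n" using vc by simp
  have pow: "(\<Sum>j<n. (M ^\<^sub>m l) $$ (i, j) * v $ j) = k ^ l * v $ i" for l
  proof -
    have "(\<Sum>j<n. (M ^\<^sub>m l) $$ (i, j) * v $ j) = (M ^\<^sub>m l *\<^sub>v v) $ i"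
      using i vc M pow_carrier_mat[OF M, of l]
      by (auto simp: scalar_prod_def atLeast0LessThan intro!: sum.cong)
    also have "M ^\<^sub>m l *\<^sub>v v = k ^ l \<cdot>\<^sub>v v"
      by (rule eigenvector_pow[OF M v])
    finally show ?thesis using i vc by simp
  qed
  have "(char_deriv_mat M *\<^sub>v v) $ i = (\<Sum>j<n. (\<Sum>l<n. coeff ?p l * (M ^\<^sub>m l) $$ (i, j)) * v $ j)"
    using i vc M by (auto simp: char_deriv_mat_def coeff_pderiv scalar_prod_def atLeast0LessThan intro!: sum.cong)
  also have "\<dots> = (\<Sum>l<n. coeff ?p l * (\<Sum>j<n. (M ^\<^sub>m l) $$ (i, j) * v $ j))"
    by (simp add: sum_distrib_left sum_distrib_right mult.assoc) (rule sum.swap)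
  also have "\<dots> = (\<Sum>l<n. coeff ?p l * k ^ l) * v $ i"
    by (simp add: pow sum_distrib_right mult.assoc)
  also have "(\<Sum>l<n. coeff ?p l * k ^ l) = poly ?p k"
    unfolding poly_altdef
    by (rule sum.mono_neutral_right) (use deg in \<open>auto simp: coeff_eq_0\<close>)
  finally show "(char_deriv_mat M *\<^sub>v v) $ i = (poly ?p k \<cdot>\<^sub>v v) $ i"
    using i vc by simp
qed (use M v in \<open>auto simp: char_deriv_mat_def eigenvector_def\<close>)

section \<open>Simple eigenvalues and simultaneous diagonalisation\<close>

lemma simple_roots_imp_distinct_roots:
  fixes p :: "'a::alg_closed_field poly"
  assumes p: "p \<noteq> 0" and simple: "\<And>x. poly p x = 0 \<Longrightarrow> poly (pderiv p) x \<noteq> 0"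
  shows "\<exists>as. length as = degree p \<and> distinct as \<and> (\<forall>x\<in>set as. poly p x = 0)"
proof -
  obtain A where A: "size A = degree p" "p = smult (lead_coeff p) (\<Prod>x\<in>#A. [:-x, 1:])"
    using alg_closed_imp_factorization[OF p] by blast
  obtain as where as: "mset as = A" using ex_mset by blast
  have root: "poly p x = 0" if x: "x \<in> set as" for x
  proof -
    obtain B where "A = add_mset x B" using x as by (metis mset_add set_mset_mset)
    then show ?thesis by (subst A(2)) simp
  qed
  \<comment> \<open>A root listed twice would split off the square of a linear factor and so be a
    root of the derivative as well.\<close>
  have "distinct as"
  proof (rule ccontr)
    assume "\<not> distinct as"
    then obtain xs ys zs x where "as = xs @ [x] @ ys @ [x] @ zs"
      using not_distinct_decomp by blast
    then have "A = add_mset x (add_mset x (mset (xs @ ys @ zs)))" using as by simp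
    moreover obtain l where "p = smult l (\<Prod>x\<in>#A. [:-x, 1:])" using A(2) by blast
    ultimately have "p = [:-x, 1:] * ([:-x, 1:] * smult l (\<Prod>x\<in>#mset (xs @ ys @ zs). [:-x, 1:]))"
      by simp
    then obtain q where q: "p = [:-x, 1:] * ([:-x, 1:] * q)" by blast
    have "poly p x = 0" "poly (pderiv p) x = 0"
      unfolding q by (simp_all only: pderiv_mult poly_mult poly_add) simp_all
    then show False using simple by blast
  qed
  moreover have "length as = degree p" using A(1) as by (metis size_mset)
  ultimately show ?thesis using root by blast
qed

text \<open>Apply \<open>M\<close> to the relation and subtract \<open>k a\<close> times it: the
  term of \<open>a\<close> disappears and the others are multiplied by the nonzero
  \<open>k j - k a\<close>.\<close>

lemma eigenvectors_independent:
  fixes M :: "'a::field mat"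
  assumes M: "M \<in> carrier_mat n n"
    and "finite J" "inj_on k J" "\<And>j. j \<in> J \<Longrightarrow> eigenvector M (v j) (k j)"
    and "\<And>i. i < n \<Longrightarrow> (\<Sum>j\<in>J. c j * v j $ i) = 0" "j \<in> J"
  shows "c j = 0"
  using assms(2-)
proof (induction J arbitrary: c j rule: finite_induct)
  case (insert a J)
  have J0: "c j = 0" if j: "j \<in> J" for j
  proof -
    have "c j * (k j - k a) = 0"
    proof (rule insert.IH[of "\<lambda>j. c j * (k j - k a)"])
      fix i assume i: "i < n"
      have ev: "k j * v j $ i = (\<Sum>l<n. M $$ (i, l) * v j $ l)" if "j \<in> insert a J" for j
      proof -
        have vj: "v j \<in> carrier_vec n" "M *\<^sub>v v j = k j \<cdot>\<^sub>v v j"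
          using insert.prems(2)[OF that] M by (auto simp: eigenvector_def)
        have "k j * v j $ i = (k j \<cdot>\<^sub>v v j) $ i" using i vj by simp
        also have "\<dots> = (M *\<^sub>v v j) $ i" by (simp add: vj(2))
        also have "\<dots> = (\<Sum>l<n. M $$ (i, l) * v j $ l)"
          using i vj(1) M by (auto simp: scalar_prod_def atLeast0LessThan intro!: sum.cong)
        finally show ?thesis .
      qed
      have "(\<Sum>j\<in>insert a J. c j * (k j - k a) * v j $ i)
          = (\<Sum>j\<in>insert a J. c j * (k j * v j $ i)) - k a * (\<Sum>j\<in>insert a J. c j * v j $ i)"
        unfolding sum_distrib_left sum_subtractf[symmetric]
        by (rule sum.cong) (auto simp: algebra_simps)
      also have "(\<Sum>j\<in>insert a J. c j * (k j * v j $ i))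
          = (\<Sum>j\<in>insert a J. \<Sum>l<n. M $$ (i, l) * (c j * v j $ l))"
        by (rule sum.cong) (auto simp: ev sum_distrib_left mult_ac simp del: insert_iff)
      also have "\<dots> = (\<Sum>l<n. M $$ (i, l) * (\<Sum>j\<in>insert a J. c j * v j $ l))"
        by (subst sum.swap) (simp add: sum_distrib_left del: sum.insert)
      also have "\<dots> = 0"
        by (intro sum.neutral ballI) (simp only: insert.prems(3) lessThan_iff mult_zero_right)
      also have "k a * (\<Sum>j\<in>insert a J. c j * v j $ i) = 0"
        by (simp only: insert.prems(3)[OF i] mult_zero_right)
      finally show "(\<Sum>j\<in>J. c j * (k j - k a) * v j $ i) = 0"
        using insert.hyps by simp
    qed (use insert.prems j in \<open>auto simp: inj_on_def\<close>)
    moreover have "k j \<noteq> k a" using insert.prems(1) insert.hyps j by (auto simp: inj_on_def)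
    ultimately show ?thesis by simp
  qed
  have va: "v a \<in> carrier_vec n" "v a \<noteq> 0\<^sub>v n"
    using insert.prems(2)[of a] M by (auto simp: eigenvector_def)
  then obtain i where i: "i < n" "v a $ i \<noteq> 0" by (metis eq_vecI carrier_vecD index_zero_vec)
  have "c a * v a $ i = 0"
    using insert.prems(3)[OF i(1)] insert.hyps J0 by simp
  with i have "c a = 0" by simp
  with J0 insert.prems(4) show ?case by auto
qed simp

lemma transpose_mult_mult_index:
  assumes "W \<in> carrier_mat n n" "T \<in> carrier_mat n n" "i < n" "j < n"
  shows "(transpose_mat W * T * W) $$ (i, j) = col W i \<bullet> (T *\<^sub>v col W j)"
proof -
  have "transpose_mat W * T * W = transpose_mat W * (T * W)"
    using assms by (intro assoc_mult_mat[of _ n n _ n _ n]) auto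
  moreover have "col (T * W) j = T *\<^sub>v col W j"
    using assms by (intro col_mult2[of _ n n _ n]) auto
  ultimately show ?thesis using assms by simp
qed

text \<open>Up to the factor \<open>det T\<close>, \<open>adj_mat T * T'\<close> is the inverse of
  \<open>T\<close> times \<open>T'\<close>, an operator self-adjoint for both bilinear forms. Its
  eigenvectors, with distinct eigenvalues, are orthogonal for both; rescaling them makes
  \<open>T\<close> scalar and the base change unimodular.\<close>

lemma simultaneous_diagonalisation:
  fixes T T' :: "'a::alg_closed_field mat"
  assumes T: "T \<in> carrier_mat n n" "transpose_mat T = T"
    and T': "T' \<in> carrier_mat n n" "transpose_mat T' = T'"
    and n: "n > 0" and det: "det T \<noteq> 0" "det (char_deriv_mat (adj_mat T * T')) \<noteq> 0"
  obtains W c where "W \<in> carrier_mat n n" "det W = 1" "transpose_mat W * T * W = c \<cdot>\<^sub>m 1\<^sub>m n"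
    "diagonal_mat (transpose_mat W * T' * W)"
proof -
  define M where "M = adj_mat T * T'"
  have aT: "adj_mat T \<in> carrier_mat n n" using adj_mat[OF T(1)] by simp
  have M: "M \<in> carrier_mat n n" using aT T' by (auto simp: M_def)
  \<comment> \<open>A multiple eigenvalue would give an eigenvector in the kernel of
    \<open>char_deriv_mat M\<close>.\<close>
  have simple: "poly (pderiv (char_poly M)) x \<noteq> 0" if root: "poly (char_poly M) x = 0" for x
  proof
    assume 0: "poly (pderiv (char_poly M)) x = 0"
    obtain v where v: "eigenvector M v x"
      using root eigenvalue_root_char_poly[OF M] by (auto simp: eigenvalue_def)
    then have vc: "v \<in> carrier_vec n" "v \<noteq> 0\<^sub>v n" using M by (auto simp: eigenvector_def)
    have "char_deriv_mat M *\<^sub>v v = 0\<^sub>v n"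
      using char_deriv_mat_eigenvector[OF M v n] 0 vc by auto
    then have "det (char_deriv_mat M) = 0"
      using det_0_iff_vec_prod_zero_field[OF char_deriv_mat_carrier[OF M]] vc by blast
    then show False using det by (simp add: M_def)
  qed
  have deg: "degree (char_poly M) = n" using degree_monic_char_poly[OF M] by simp
  then have "char_poly M \<noteq> 0" using n by auto
  from simple_roots_imp_distinct_roots[OF this simple] obtain as
    where as: "length as = n" "distinct as" "\<And>x. x \<in> set as \<Longrightarrow> poly (char_poly M) x = 0"
    by (auto simp: deg)
  define k where "k i = as ! i" for i
  have k_inj: "inj_on k {..<n}"
    using as by (auto simp: k_def inj_on_def nth_eq_iff_index_eq)
  have "\<exists>v. eigenvector M v (k i)" if "i < n" for i
    using as that eigenvalue_root_char_poly[OF M] by (auto simp: k_def eigenvalue_def)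
  then obtain v where v: "\<And>i. i < n \<Longrightarrow> eigenvector M (v i) (k i)" by metis
  have vc: "v i \<in> carrier_vec n" "M *\<^sub>v v i = k i \<cdot>\<^sub>v v i" if "i < n" for i
    using v[OF that] M by (auto simp: eigenvector_def)
  define B where "B S i j = v i \<bullet> (S *\<^sub>v v j)" for S i j
  have B_expand: "B S i j = (\<Sum>a<n. \<Sum>b<n. v i $ a * (S $$ (a, b) * v j $ b))"
    if "S \<in> carrier_mat n n" "i < n" "j < n" for S i j
    using vc that by (auto simp: B_def scalar_prod_def atLeast0LessThan sum_distrib_left intro!: sum.cong)
  have B_sym: "B S i j = B S j i"
    if S: "S \<in> carrier_mat n n" "transpose_mat S = S" and ij: "i < n" "j < n" for S i j
  proof -
    have sym: "S $$ (a, b) = S $$ (b, a)" if "a < n" "b < n" for a b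
      using that S by (metis carrier_matD index_transpose_mat(1))
    have "B S i j = (\<Sum>b<n. \<Sum>a<n. v i $ a * (S $$ (a, b) * v j $ b))"
      unfolding B_expand[OF S(1) ij] by (rule sum.swap)
    also have "\<dots> = B S j i"
      unfolding B_expand[OF S(1) ij(2,1)] by (intro sum.cong refl) (simp add: sym mult_ac)
    finally show ?thesis .
  qed
  have TM: "T * M = det T \<cdot>\<^sub>m T'"
  proof -
    have "T * M = (T * adj_mat T) * T'"
      unfolding M_def using T T' aT by (subst assoc_mult_mat[of _ n n _ n _ n]) auto
    then show ?thesis using adj_mat[OF T(1)] T'
      by (simp add: mult_smult_assoc_mat[of "1\<^sub>m n" n n T' n])
  qed
  have BB': "det T * B T' i j = k j * B T i j" if ij: "i < n" "j < n" for i j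
  proof -
    have "T *\<^sub>v (M *\<^sub>v v j) = (det T \<cdot>\<^sub>m T') *\<^sub>v v j"
      using vc(1)[OF ij(2)] by (simp only: assoc_mult_mat_vec[OF T(1) M, symmetric] TM)
    also have "\<dots> = det T \<cdot>\<^sub>v (T' *\<^sub>v v j)"
      using T' vc ij by (intro eq_vecI) (auto intro!: smult_scalar_prod_distrib[of _ n])
    finally have "T *\<^sub>v (M *\<^sub>v v j) = det T \<cdot>\<^sub>v (T' *\<^sub>v v j)" .
    moreover have "T *\<^sub>v (M *\<^sub>v v j) = k j \<cdot>\<^sub>v (T *\<^sub>v v j)"
      using T vc ij by (simp add: mult_mat_vec[of _ n n])
    ultimately have "v i \<bullet> (det T \<cdot>\<^sub>v (T' *\<^sub>v v j)) = v i \<bullet> (k j \<cdot>\<^sub>v (T *\<^sub>v v j))" by simp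
    then show ?thesis using T T' vc ij
      by (simp add: B_def)
  qed
  \<comment> \<open>Both forms are symmetric, so exchanging \<open>i\<close> and \<open>j\<close> in
    \<open>BB'\<close> shows that \<open>k i\<close> and \<open>k j\<close> have the same product
    with \<open>B T i j\<close>.\<close>
  have B0: "B T i j = 0" if "i < n" "j < n" "i \<noteq> j" for i j
  proof -
    have "k j * B T i j = k i * B T i j"
      using BB'[of i j] BB'[of j i] B_sym[OF T, of i j] B_sym[OF T', of i j] that by metis
    moreover have "k i \<noteq> k j" using k_inj that by (auto simp: inj_on_def)
    ultimately show ?thesis by auto
  qed
  have B'0: "B T' i j = 0" if "i < n" "j < n" "i \<noteq> j" for i j
    using BB'[of i j] B0[of i j] that det by simp
  define W0 where "W0 = mat n n (\<lambda>(i, j). v j $ i)"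
  have W0: "W0 \<in> carrier_mat n n" by (simp add: W0_def)
  have det_W0: "det W0 \<noteq> 0"
  proof
    assume "det W0 = 0"
    then obtain c where c: "c \<in> carrier_vec n" "c \<noteq> 0\<^sub>v n" "W0 *\<^sub>v c = 0\<^sub>v n"
      using det_0_iff_vec_prod_zero_field[OF W0] by blast
    have "c $ j = 0" if "j < n" for j
    proof (rule eigenvectors_independent[OF M _ k_inj, of v "\<lambda>j. c $ j"])
      fix i assume i: "i < n"
      have "(W0 *\<^sub>v c) $ i = (\<Sum>j<n. c $ j * v j $ i)"
        using i c(1) by (auto simp: W0_def scalar_prod_def atLeast0LessThan mult.commute intro!: sum.cong)
      then show "(\<Sum>j<n. c $ j * v j $ i) = 0" using c i by simp
    qed (use v that in auto)
    then show False using c by (metis eq_vecI carrier_vecD index_zero_vec)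
  qed
  have colW0: "col W0 j = v j" if "j < n" for j
    using vc[OF that] that by (auto simp: W0_def)
  have BT_eq: "transpose_mat W0 * T * W0 = mat n n (\<lambda>(i, j). if i = j then B T i i else 0)"
  proof (rule eq_matI)
    fix i j assume "i < dim_row (mat n n (\<lambda>(i, j). if i = j then B T i i else 0))"
      "j < dim_col (mat n n (\<lambda>(i, j). if i = j then B T i i else 0))"
    then have ij: "i < n" "j < n" by auto
    show "(transpose_mat W0 * T * W0) $$ (i, j) = mat n n (\<lambda>(i, j). if i = j then B T i i else 0) $$ (i, j)"
      using B0[OF ij] ij by (simp only: transpose_mult_mult_index[OF W0 T(1) ij] colW0) (auto simp: B_def)
  qed (use W0 T in auto)
  \<comment> \<open>The Gram determinant is nonzero, so no eigenvector is isotropic for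
    \<open>T\<close>.\<close>
  have "(\<Prod>i<n. B T i i) = det (transpose_mat W0 * T * W0)"
    by (simp add: BT_eq det_diag_of)
  also have "\<dots> = det W0 * det T * det W0"
    using W0 T by (simp add: det_mult[of _ n] det_transpose[of _ n])
  finally have "(\<Prod>i<n. B T i i) \<noteq> 0" using det det_W0 by simp
  then have Bii: "B T i i \<noteq> 0" if "i < n" for i using that by auto
  \<comment> \<open>The square roots \<open>t i\<close> normalise all \<open>B T i i\<close> to 1.
    The common factor \<open>u\<close> then corrects the determinant to 1 at the price of turning
    the identity into the scalar matrix of \<open>u^2\<close>.\<close>
  have "\<exists>t. t ^ 2 = inverse (B T i i)" for i by (rule nth_root_exists) simp
  then obtain t where t: "\<And>i. t i ^ 2 = inverse (B T i i)" by metis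
  have t0: "t i \<noteq> 0" if "i < n" for i
    using t[of i] Bii[OF that] by auto
  obtain u where u: "u ^ n = inverse (det W0 * (\<Prod>i<n. t i))"
    using nth_root_exists[OF n] by blast
  define s where "s i = u * t i" for i
  define W where "W = W0 * mat n n (\<lambda>(i, j). if i = j then s i else 0)"
  have W: "W \<in> carrier_mat n n" using W0 by (auto simp: W_def)
  have colW: "col W j = s j \<cdot>\<^sub>v v j" if j: "j < n" for j
  proof (rule eq_vecI)
    fix i assume "i < dim_vec (s j \<cdot>\<^sub>v v j)"
    then have i: "i < n" using vc[OF j] by simp
    have "col W j $ i = (\<Sum>l<n. v l $ i * (if l = j then s l else 0))"
      using i j by (auto simp: W_def W0_def scalar_prod_def atLeast0LessThan intro!: sum.cong)
    also have "\<dots> = s j * v j $ i" using j by (simp add: if_distrib cong: if_cong)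
    finally show "col W j $ i = (s j \<cdot>\<^sub>v v j) $ i" using i vc[OF j] by simp
  qed (use vc[OF j] W in auto)
  have entry: "(transpose_mat W * S * W) $$ (i, j) = s i * s j * B S i j"
    if S: "S \<in> carrier_mat n n" and ij: "i < n" "j < n" for S i j
  proof -
    have "(transpose_mat W * S * W) $$ (i, j) = (s i \<cdot>\<^sub>v v i) \<bullet> (S *\<^sub>v (s j \<cdot>\<^sub>v v j))"
      by (simp only: transpose_mult_mult_index[OF W S ij] colW ij)
    also have "\<dots> = s i * s j * B S i j"
      using vc ij S by (simp add: B_def mult_mat_vec[of _ n n] mult_ac)
    finally show ?thesis .
  qed
  show ?thesis
  proof (rule that[OF W])
    show "det W = 1"
    proof -
      have "det W = det W0 * (\<Prod>i<n. s i)"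
        unfolding W_def by (subst det_mult[of _ n]) (use W0 in \<open>auto simp: det_diag_of\<close>)
      also have "\<dots> = u ^ n * (det W0 * (\<Prod>i<n. t i))"
        by (simp add: s_def prod.distrib)
      also have "\<dots> = 1"
        unfolding u by (rule left_inverse) (use det_W0 t0 in auto)
      finally show ?thesis .
    qed
    show "transpose_mat W * T * W = u\<^sup>2 \<cdot>\<^sub>m 1\<^sub>m n"
    proof (rule eq_matI)
      fix i j assume "i < dim_row (u\<^sup>2 \<cdot>\<^sub>m 1\<^sub>m n)" "j < dim_col (u\<^sup>2 \<cdot>\<^sub>m 1\<^sub>m n)"
      then have ij: "i < n" "j < n" by auto
      have "s i * s i * B T i i = u\<^sup>2 * (t i ^ 2 * B T i i)"
        by (simp add: s_def power2_eq_square mult_ac)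
      also have "\<dots> = u\<^sup>2" using t[of i] Bii[of i] ij by simp
      finally show "(transpose_mat W * T * W) $$ (i, j) = (u\<^sup>2 \<cdot>\<^sub>m 1\<^sub>m n) $$ (i, j)"
        using ij B0[of i j] by (auto simp: entry[OF T(1) ij])
    qed (use W T in auto)
    show "diagonal_mat (transpose_mat W * T' * W)"
      unfolding diagonal_mat_def using W T' B'0 entry[OF T'(1)] by auto
  qed
qed

section \<open>Explicit invariants and the slice\<close>

definition pencil :: "nat \<Rightarrow> 'k::field \<Rightarrow> 'k tpoly mat" where
  "pencil g a = tconst a \<cdot>\<^sub>m generic_sym_mat g 0 - generic_sym_mat g 1"

definition pencil_at :: "nat \<Rightarrow> (tvar \<Rightarrow> 'k::field) \<Rightarrow> 'k \<Rightarrow> 'k mat" where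
  "pencil_at g p a = a \<cdot>\<^sub>m sym_mat g p 0 - sym_mat g p 1"

text \<open>Adjugates keep the expression polynomial where inverses would not. They also stay
  nonzero at a pencil with one simple zero eigenvalue, where they have rank one and single out one
  row and column.\<close>

definition tr_invariant :: "nat \<Rightarrow> 'k::field \<Rightarrow> 'k \<Rightarrow> nat \<Rightarrow> 'k tpoly" where
  "tr_invariant g a b l = mat_tr (adj_mat (pencil g a) * generic_sym_mat g l *
     (adj_mat (pencil g b) * generic_sym_mat g l))"

lemma generic_sym_mat_carrier [simp]: "generic_sym_mat g l \<in> carrier_mat g g"
  and generic_sym_mat_dim [simp]: "dim_row (generic_sym_mat g l) = g" "dim_col (generic_sym_mat g l) = g"
  by (simp_all add: generic_sym_mat_def)

lemma pencil_carrier [simp]: "pencil g a \<in> carrier_mat g g"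
  unfolding pencil_def by (rule minus_carrier_mat) (simp add: generic_sym_mat_def)

lemma pencil_at_carrier [simp]: "pencil_at g p a \<in> carrier_mat g g"
  by (simp add: pencil_at_def minus_carrier_mat[OF sym_mat_carrier])

lemma map_eval_pencil: "map_mat (eval p) (pencil g a) = pencil_at g p a"
  by (rule eq_matI)
     (auto simp: pencil_def pencil_at_def generic_sym_mat_def sym_mat_def eval.hom_minus eval.hom_mult)

lemma pencil_tpoly_mats: "r \<ge> 1 \<Longrightarrow> pencil g a \<in> tpoly_mats g r g"
  using generic_sym_mat_tpoly_mats[of 0 r g] generic_sym_mat_tpoly_mats[of 1 r g]
  by (auto simp: pencil_def tpoly_mats_def intro!: tpoly_diff tpoly_mult minus_carrier_mat)

lemma pencil_at_act:
  assumes L: "L \<in> carrier_mat g g"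
  shows "pencil_at g (sym_act g L p) a = L * pencil_at g p a * transpose_mat L"
proof -
  have "L * pencil_at g p a = a \<cdot>\<^sub>m (L * sym_mat g p 0) - L * sym_mat g p 1"
    unfolding pencil_at_def using L
    by (simp add: mult_minus_distrib_mat[of _ g g _ g] mult_smult_distrib[of _ g g _ g])
  also have "\<dots> * transpose_mat L = a \<cdot>\<^sub>m (L * sym_mat g p 0) * transpose_mat L - L * sym_mat g p 1 * transpose_mat L"
    using L by (intro minus_mult_distrib_mat[of _ g g _ _ g]) auto
  also have "a \<cdot>\<^sub>m (L * sym_mat g p 0) * transpose_mat L = a \<cdot>\<^sub>m (L * sym_mat g p 0 * transpose_mat L)"
    using L by (intro mult_smult_assoc_mat[of _ g g _ g]) auto
  finally show ?thesis
    unfolding pencil_at_def[of g "sym_act g L p"] sym_mat_act[OF L] by simp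
qed

lemma det_congruence:
  fixes L Y :: "'k::field mat"
  assumes "L \<in> carrier_mat n n" "det L = 1" "Y \<in> carrier_mat n n"
  shows "det (L * Y * transpose_mat L) = det Y"
  using assms by (simp add: det_mult[of _ n] det_transpose[of _ n])

lemma det_pencil_invariant:
  "r \<ge> 1 \<Longrightarrow> det (pencil g (a :: 'k::alg_closed_field)) \<in> carrier (SL_invariant_ring g r)"
  by (intro invariantI tpoly_mats_det[where n = g] pencil_tpoly_mats)
     (simp_all add: eval.hom_det[symmetric] map_eval_pencil pencil_at_act det_congruence del: eval.hom_det)

lemma det_generic_invariant:
  "l \<le> r \<Longrightarrow> det (generic_sym_mat g l) \<in> carrier (SL_invariant_ring g r :: 'k::alg_closed_field tpoly ring)"
  by (intro invariantI tpoly_mats_det[where n = g] generic_sym_mat_tpoly_mats)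
     (simp_all add: eval.hom_det[symmetric] map_eval_generic_sym_mat sym_mat_act
        det_congruence[OF _ _ sym_mat_carrier] del: eval.hom_det)

lemma eval_tr_invariant:
  "eval p (tr_invariant g a b l) = mat_tr (adj_mat (pencil_at g p a) * sym_mat g p l *
     (adj_mat (pencil_at g p b) * sym_mat g p l))"
proof -
  have tr: "eval p (mat_tr A) = mat_tr (map_mat (eval p) A)" if "A \<in> carrier_mat g g" for A
    using that by (auto simp: mat_tr_def eval.hom_sum intro!: sum.cong)
  have adj: "adj_mat (pencil g c) \<in> carrier_mat g g" for c :: 'a
    by (rule adj_mat(1)) simp
  have G: "generic_sym_mat g l \<in> carrier_mat g g" by simp
  have AG: "adj_mat (pencil g c) * generic_sym_mat g l \<in> carrier_mat g g" for c :: 'a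
    using adj G by (rule mult_carrier_mat)
  show ?thesis
    unfolding tr_invariant_def tr[OF mult_carrier_mat[OF AG AG]] eval.mat_hom_mult[OF AG AG]
      eval.mat_hom_mult[OF adj G] eval.adj_mat_hom map_eval_pencil map_eval_generic_sym_mat ..
qed

lemma tr_invariant_invariant:
  fixes a b :: "'k::alg_closed_field"
  assumes "r \<ge> 1" "l \<le> r"
  shows "tr_invariant g a b l \<in> carrier (SL_invariant_ring g r)"
proof (rule invariantI_generic)
  have "adj_mat (pencil g a) * generic_sym_mat g l * (adj_mat (pencil g b) * generic_sym_mat g l) \<in> tpoly_mats g r g"
    using assms by (intro tpoly_mats_mult tpoly_mats_adj pencil_tpoly_mats generic_sym_mat_tpoly_mats)
  then show "tr_invariant g a b l \<in> carrier (tpoly_ring g r)"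
    unfolding tr_invariant_def mat_tr_def by (intro tpoly_sum) (auto simp: tpoly_mats_def)
  \<comment> \<open>At this point \<open>T\<close> is zero and \<open>T'\<close> is the identity, so
    every pencil becomes minus the identity and both determinants are nonzero for all
    \<open>a\<close> and \<open>b\<close>.\<close>
  define p0 :: "tvar \<Rightarrow> 'k" where "p0 = (\<lambda>(l, i, j). if l = 1 \<and> i = j then 1 else 0)"
  have "pencil_at g p0 c = (- 1) \<cdot>\<^sub>m 1\<^sub>m g" for c
    by (rule eq_matI) (auto simp: pencil_at_def sym_mat_def p0_def)
  then show "eval p0 (det (pencil g a) * det (pencil g b)) \<noteq> 0"
    by (simp add: eval.hom_mult eval.hom_det[symmetric] map_eval_pencil del: eval.hom_det)
  fix L :: "'k mat" and p
  assume "L \<in> carrier_mat g g" "det L = 1" "eval p (det (pencil g a) * det (pencil g b)) \<noteq> 0"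
  then show "eval (sym_act g L p) (tr_invariant g a b l) = eval p (tr_invariant g a b l)"
    unfolding eval_tr_invariant
    by (simp only: pencil_at_act sym_mat_act)
       (rule mat_tr_adj_congruence[of _ g],
        simp_all add: eval.hom_mult eval.hom_det[symmetric] map_eval_pencil del: eval.hom_det)
qed

text \<open>The determinant is zero, so the adjugate is annihilated by the diagonal matrix from both
  sides. This kills every entry outside \<open>(i, i)\<close>, and the remaining one is the product
  of the nonzero diagonal entries.\<close>

lemma adj_mat_diag_of:
  fixes d :: "nat \<Rightarrow> 'k::field"
  assumes i: "i < n" "d i = 0" and d: "\<And>a. a < n \<Longrightarrow> a \<noteq> i \<Longrightarrow> d a \<noteq> 0"
  shows "\<exists>\<kappa>. \<kappa> \<noteq> 0 \<and> adj_mat (diag_of n d) = mat n n (\<lambda>(a, b). if a = i \<and> b = i then \<kappa> else 0)"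
proof (intro exI conjI)
  let ?D = "diag_of n d" and ?A = "adj_mat (diag_of n d)"
  have D: "?D \<in> carrier_mat n n" by simp
  have A: "?A \<in> carrier_mat n n" using adj_mat[OF D] by simp
  have det0: "det ?D = 0" unfolding det_diag_of using i by (intro prod_zero) auto
  have right: "?A $$ (a, b) * d b = 0" if "a < n" "b < n" for a b
  proof -
    have "(?A * ?D) $$ (a, b) = (\<Sum>c<n. ?A $$ (a, c) * (if c = b then d c else 0))"
      using that A by (auto simp: scalar_prod_def atLeast0LessThan intro!: sum.cong)
    also have "\<dots> = ?A $$ (a, b) * d b" using that by (simp add: if_distrib cong: if_cong)
    finally show ?thesis using adj_mat(3)[OF D] det0 that by simp
  qed
  have left: "d a * ?A $$ (a, b) = 0" if "a < n" "b < n" for a b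
  proof -
    have "(?D * ?A) $$ (a, b) = (\<Sum>c<n. (if a = c then d a else 0) * ?A $$ (c, b))"
      using that A by (auto simp: scalar_prod_def atLeast0LessThan intro!: sum.cong)
    also have "\<dots> = d a * ?A $$ (a, b)" using that by (simp add: if_distrib[of "\<lambda>x. x * _"] cong: if_cong)
    finally show ?thesis using adj_mat(2)[OF D] det0 that by simp
  qed
  show "?A = mat n n (\<lambda>(a, b). if a = i \<and> b = i then ?A $$ (i, i) else 0)"
  proof (rule eq_matI)
    fix a b assume "a < dim_row (mat n n (\<lambda>(a, b). if a = i \<and> b = i then ?A $$ (i, i) else 0))"
      "b < dim_col (mat n n (\<lambda>(a, b). if a = i \<and> b = i then ?A $$ (i, i) else 0))"
    then have ab: "a < n" "b < n" by auto
    show "?A $$ (a, b) = mat n n (\<lambda>(a, b). if a = i \<and> b = i then ?A $$ (i, i) else 0) $$ (a, b)"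
      using ab left[OF ab] right[OF ab] d[of a] d[of b] by auto
  qed (use A in auto)
  \<comment> \<open>\<open>s\<close> enumerates the indices other than \<open>i\<close>, those left
    after deleting row and column \<open>i\<close>.\<close>
  define s where "s a = (if a < i then a else Suc a)" for a
  have "mat_delete ?D i i = diag_of (n - 1) (\<lambda>a. d (s a))"
    using i by (auto simp: mat_delete_def s_def intro!: eq_matI)
  then have "?A $$ (i, i) = (\<Prod>a<n - 1. d (s a))"
    using i by (simp add: adj_mat_def cofactor_def det_diag_of flip: mult_2)
  also have "\<dots> \<noteq> 0" using d by (auto simp: s_def)
  finally show "?A $$ (i, i) \<noteq> 0" .
qed

lemma mat_tr_single_entries:
  fixes X :: "'k::field mat"
  assumes X: "X \<in> carrier_mat n n" and ij: "i < n" "j < n"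
  shows "mat_tr (mat n n (\<lambda>(a, b). if a = i \<and> b = i then \<kappa> else 0) * X *
      (mat n n (\<lambda>(a, b). if a = j \<and> b = j then \<mu> else 0) * X)) = \<kappa> * \<mu> * X $$ (i, j) * X $$ (j, i)"
proof -
  have single: "(mat n n (\<lambda>(a, b). if a = i \<and> b = i then c else 0) * X) $$ (a, b) = (if a = i then c * X $$ (i, b) else 0)"
    if "i < n" "a < n" "b < n" for i a b c
  proof -
    have "(mat n n (\<lambda>(a, b). if a = i \<and> b = i then c else 0) * X) $$ (a, b)
        = (\<Sum>k<n. (if a = i \<and> k = i then c else 0) * X $$ (k, b))"
      using that X by (simp add: scalar_prod_def atLeast0LessThan cong: sum.cong_simp)
    also have "\<dots> = (\<Sum>k<n. if k = i then (if a = i then c * X $$ (k, b) else 0) else 0)"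
      by (rule sum.cong) auto
    finally show ?thesis using that by simp
  qed
  let ?A = "mat n n (\<lambda>(a, b). if a = i \<and> b = i then \<kappa> else 0) * X"
  let ?B = "mat n n (\<lambda>(a, b). if a = j \<and> b = j then \<mu> else 0) * X"
  have "mat_tr (?A * ?B) = (\<Sum>a<n. \<Sum>b<n. ?A $$ (a, b) * ?B $$ (b, a))"
    unfolding mat_tr_def using X
    by (simp add: times_mat_def[of ?A ?B] scalar_prod_def atLeast0LessThan)
  also have "\<dots> = (\<Sum>a<n. \<Sum>b<n. if b = j then (if a = i then \<kappa> * X $$ (i, b) * (\<mu> * X $$ (j, a)) else 0) else 0)"
    by (intro sum.cong refl) (simp add: single ij)
  also have "\<dots> = \<kappa> * \<mu> * X $$ (i, j) * X $$ (j, i)"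
    using ij by (simp add: mult_ac)
  finally show ?thesis .
qed

section \<open>The slice \<open>S\<close> and its coordinates\<close>

definition slice :: "(tvar \<Rightarrow> 'k::field) \<Rightarrow> tvar \<Rightarrow> 'k" where
  "slice q = (\<lambda>(l, i, j). if l = 0 then (if i = j then q (0, 0, 0) else 0)
     else if l = 1 then (if i = j then q (1, i, i) else 0) else q (l, i, j))"

definition slice_rest :: "nat \<Rightarrow> nat \<Rightarrow> tvar set" where
  "slice_rest g r = {(l, i, j). 2 \<le> l \<and> l \<le> r \<and> i \<le> j \<and> j < g}"

text \<open>Coordinates of \<open>S\<close>: \<open>(0, 0, 0)\<close> holds the scalar
  \<open>c\<close>, \<open>(1, i, i)\<close> the diagonal entry \<open>a_i\<close>, and the rest are
  the free entries of the later matrices. At positions in \<open>tvars g r\<close>,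
  \<open>slice q\<close> depends on \<open>q\<close> only through these.\<close>

definition slice_vars :: "nat \<Rightarrow> nat \<Rightarrow> tvar set" where
  "slice_vars g r = insert (0, 0, 0) ((\<lambda>i. (1, i, i)) ` {..<g} \<union> slice_rest g r)"

lemma sym_mat_slice_0: "sym_mat g (slice q) 0 = q (0, 0, 0) \<cdot>\<^sub>m 1\<^sub>m g"
  by (rule eq_matI) (auto simp: sym_mat_def slice_def min_def max_def)

lemma sym_mat_slice_1: "sym_mat g (slice q) 1 = diag_of g (\<lambda>i. q (1, i, i))"
  by (rule eq_matI) (auto simp: sym_mat_def slice_def min_def max_def)

lemma pencil_at_slice:
  assumes "q (0, 0, 0) = 1"
  shows "pencil_at g (slice q) a = diag_of g (\<lambda>i. a - q (1, i, i))"
  unfolding pencil_at_def sym_mat_slice_0 sym_mat_slice_1 using assms by (intro eq_matI) auto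

text \<open>The pencil at \<open>\<alpha> i\<close> is diagonal with its only zero at position
  \<open>i\<close>, so its adjugate is a multiple of a matrix unit; likewise for \<open>j\<close>.
  The constant \<open>\<kappa>\<close> depends only on \<open>\<alpha>\<close>, \<open>i\<close>,
  \<open>j\<close> and \<open>g\<close>, hence is the same for all \<open>q\<close>.\<close>

lemma eval_tr_invariant_slice:
  fixes \<alpha> :: "nat \<Rightarrow> 'k::field"
  assumes \<alpha>: "inj \<alpha>" and ij: "i \<le> j" "j < g" and l: "2 \<le> l"
  obtains \<kappa> where "\<kappa> \<noteq> 0"
    "\<And>q. q (0, 0, 0) = 1 \<Longrightarrow> (\<And>a. a < g \<Longrightarrow> q (1, a, a) = \<alpha> a) \<Longrightarrow>
       eval (slice q) (tr_invariant g (\<alpha> i) (\<alpha> j) l) = \<kappa> * q (l, i, j) ^ 2"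
proof -
  have adj: "\<exists>\<kappa>. \<kappa> \<noteq> 0 \<and> adj_mat (diag_of g (\<lambda>a. \<alpha> i - \<alpha> a)) =
      mat g g (\<lambda>(a, b). if a = i \<and> b = i then \<kappa> else 0)" if "i < g" for i
    using that \<alpha> by (intro adj_mat_diag_of) (auto simp: inj_def)
  obtain \<kappa> \<mu> where \<kappa>: "\<kappa> \<noteq> 0" "adj_mat (diag_of g (\<lambda>a. \<alpha> i - \<alpha> a)) =
      mat g g (\<lambda>(a, b). if a = i \<and> b = i then \<kappa> else 0)"
    and \<mu>: "\<mu> \<noteq> 0" "adj_mat (diag_of g (\<lambda>a. \<alpha> j - \<alpha> a)) =
      mat g g (\<lambda>(a, b). if a = j \<and> b = j then \<mu> else 0)"
    using adj[of i] adj[of j] ij by auto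
  show ?thesis
  proof (rule that[of "\<kappa> * \<mu>"])
    show "\<kappa> * \<mu> \<noteq> 0" using \<kappa> \<mu> by simp
    fix q :: "tvar \<Rightarrow> 'k" assume q: "q (0, 0, 0) = 1" "\<And>a. a < g \<Longrightarrow> q (1, a, a) = \<alpha> a"
    have P: "pencil_at g (slice q) c = diag_of g (\<lambda>a. c - \<alpha> a)" for c
      unfolding pencil_at_slice[where q = q, OF q(1)] by (rule eq_matI) (auto simp: q(2)[unfolded One_nat_def])
    have "eval (slice q) (tr_invariant g (\<alpha> i) (\<alpha> j) l)
        = \<kappa> * \<mu> * sym_mat g (slice q) l $$ (i, j) * sym_mat g (slice q) l $$ (j, i)"
      unfolding eval_tr_invariant P \<kappa> \<mu> using ij by (intro mat_tr_single_entries) auto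
    also have "\<dots> = \<kappa> * \<mu> * q (l, i, j) ^ 2"
      using ij l by (simp add: sym_mat_def slice_def min_def max_def power2_eq_square)
    finally show "eval (slice q) (tr_invariant g (\<alpha> i) (\<alpha> j) l) = \<kappa> * \<mu> * q (l, i, j) ^ 2" .
  qed
qed

lemma finite_slice_rest: "finite (slice_rest g r)"
  and card_slice_rest: "card (slice_rest g r) = (r - 1) * (g * (g + 1) div 2)"
proof -
  let ?I = "{2..r} \<times> (SIGMA j:{..<g}. {..j})"
  have eq: "slice_rest g r = (\<lambda>(l, j, i). (l, i, j)) ` ?I"
    by (auto simp: slice_rest_def image_iff)
  show "finite (slice_rest g r)" unfolding eq by auto
  have "card (slice_rest g r) = card ?I"
    unfolding eq by (rule card_image) (auto simp: inj_on_def)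
  also have "\<dots> = (r - 1) * (\<Sum>j<g. Suc j)" by (simp add: card_cartesian_product)
  also have "(\<Sum>j<g. Suc j) = g * (g + 1) div 2"
    by (induction g) auto
  finally show "card (slice_rest g r) = (r - 1) * (g * (g + 1) div 2)" .
qed

lemma finite_slice_vars: "finite (slice_vars g r)"
  by (simp add: slice_vars_def finite_slice_rest)

lemma card_slice_vars:
  assumes "r \<ge> 1"
  shows "card (slice_vars g r) = (r + 1) * (g * (g + 1) div 2) - g\<^sup>2 + 1"
proof -
  let ?D = "(\<lambda>i. (1::nat, i, i)) ` {..<g}"
  have "card (?D \<union> slice_rest g r) = card ?D + card (slice_rest g r)"
    by (rule card_Un_disjoint) (simp_all add: finite_slice_rest, auto simp: slice_rest_def)
  also have "card ?D = g" by (subst card_image) (auto simp: inj_on_def)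
  finally have card: "card (?D \<union> slice_rest g r) = g + (r - 1) * (g * (g + 1) div 2)"
    by (simp only: card_slice_rest)
  have "(0, 0, 0) \<notin> ?D \<union> slice_rest g r" by (auto simp: slice_rest_def)
  then have "card (slice_vars g r) = 1 + (g + (r - 1) * (g * (g + 1) div 2))"
    unfolding slice_vars_def
    using card by (subst card_insert_disjoint) (simp_all add: finite_slice_rest)
  moreover obtain r' where r': "r = Suc r'" using assms by (cases r) auto
  \<comment> \<open>Since \<open>2 * h - g^2 = g\<close>, the truncated subtraction in the formula
    is exact and leaves \<open>g\<close> beside the \<open>(r - 1) * h\<close> free entries.\<close>
  moreover define h where "h = g * (g + 1) div 2"
  moreover have "2 * h = g * g + g" by (simp add: h_def algebra_simps)
  moreover have "(r + 1) * h = r' * h + 2 * h" by (simp add: r' algebra_simps)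
  ultimately show ?thesis by (simp add: power2_eq_square del: mult_Suc)
qed

section \<open>Lower bound: a chain of primes\<close>

lemma ex_inj_nat_alg_closed: "\<exists>\<alpha> :: nat \<Rightarrow> 'k::alg_closed_field. inj \<alpha>"
  using infinite_countable_subset[OF infinite_UNIV_alg_closed] by blast

lemma slice_affine:
  "slice (\<lambda>v. q v + t * (q' v - q v)) = (\<lambda>v. slice q v + t * (slice q' v - slice q v))"
  by (auto simp: slice_def fun_eq_iff)

lemma prime_chain_exists:
  assumes g: "g \<ge> 1" and r: "r \<ge> 1"
  shows "\<exists>P :: nat \<Rightarrow> 'k::alg_closed_field tpoly set.
    (\<forall>i\<le>card (slice_vars g r). primeideal (P i) (SL_invariant_ring g r)) \<and>
    (\<forall>i<card (slice_vars g r). P i \<subset> P (Suc i))"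
proof -
  obtain \<alpha> :: "nat \<Rightarrow> 'k" where \<alpha>: "inj \<alpha>" using ex_inj_nat_alg_closed by blast
  obtain xs where xs: "set xs = slice_rest g r" "distinct xs"
    using finite_distinct_list[OF finite_slice_rest] by blast
  \<comment> \<open>The order matters: the trace invariants isolate an entry of a later matrix only
    after the scalar and the whole diagonal have been fixed.\<close>
  define vs :: "tvar list" where "vs = (0, 0, 0) # map (\<lambda>i. (1, i, i)) [0..<g] @ xs"
  have vs: "set vs = slice_vars g r" "distinct vs"
    by (auto simp: vs_def slice_vars_def xs slice_rest_def distinct_map inj_on_def atLeast0LessThan)
  then have len: "card (slice_vars g r) = length vs" using distinct_card[of vs] by simp
  have nth: "vs ! 0 = (0, 0, 0)" "i < g \<Longrightarrow> vs ! Suc i = (1, i, i)" for i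
    by (simp_all add: vs_def nth_append)
  define \<tau> :: "tvar \<Rightarrow> 'k" where "\<tau> = (\<lambda>(l, i, j). if l = 0 then 1 else if l = 1 then \<alpha> i else 0)"
  \<comment> \<open>\<open>Q k\<close> fixes the first \<open>k\<close> slice coordinates at the
    values of \<open>\<tau>\<close>, so the spaces shrink and the ideals \<open>P k\<close>
    grow.\<close>
  define Q where "Q k = {q :: tvar \<Rightarrow> 'k. \<forall>i<k. q (vs ! i) = \<tau> (vs ! i)}" for k
  define P where "P k = {F \<in> carrier (SL_invariant_ring g r). \<forall>\<sigma>\<in>slice ` Q k. eval \<sigma> F = 0}" for k
  have "primeideal (P k) (SL_invariant_ring g r)" for k
    unfolding P_def
  proof (rule primeideal_vanishing)
    have "\<tau> \<in> Q k" by (simp add: Q_def)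
    then show "slice ` Q k \<noteq> {}" by blast
    fix \<sigma> \<sigma>' t assume "\<sigma> \<in> slice ` Q k" "\<sigma>' \<in> slice ` Q k"
    then obtain q q' where q: "q \<in> Q k" "q' \<in> Q k" "\<sigma> = slice q" "\<sigma>' = slice q'" by blast
    then have "(\<lambda>v. q v + t * (q' v - q v)) \<in> Q k" by (simp add: Q_def)
    then show "(\<lambda>v. \<sigma> v + t * (\<sigma>' v - \<sigma> v)) \<in> slice ` Q k"
      unfolding q slice_affine[symmetric] by blast
  qed
  moreover have "P k \<subset> P (Suc k)" if k: "k < length vs" for k
  proof
    show "P k \<subseteq> P (Suc k)" by (auto simp: P_def Q_def)
    \<comment> \<open>Strictness needs an invariant that vanishes after fixing the
      \<open>k\<close>-th coordinate, and a point where it does not vanish before.\<close>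
    have "\<exists>F q. F \<in> carrier (SL_invariant_ring g r) \<and> (\<forall>q\<in>Q (Suc k). eval (slice q) F = 0) \<and>
        q \<in> Q k \<and> eval (slice q) F \<noteq> 0"
    proof -
      consider "k = 0" | i where "k = Suc i" "i < g" | "g < k" using not_less_eq by (cases k) auto
      then show ?thesis
      proof cases
        case 1
        let ?F = "det (generic_sym_mat g 0) + tconst (- 1) :: 'k tpoly"
        have F: "eval (slice q) ?F = q (0, 0, 0) ^ g - 1" for q :: "tvar \<Rightarrow> 'k"
          by (simp add: eval.hom_add eval.hom_det[symmetric] map_eval_generic_sym_mat sym_mat_slice_0
              del: eval.hom_det)
        show ?thesis
        proof (intro exI conjI ballI)
          show "?F \<in> carrier (SL_invariant_ring g r)"
            by (intro invariant_add invariant_tconst det_generic_invariant) simp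
          show "eval (slice q) ?F = 0" if "q \<in> Q (Suc k)" for q
            using that unfolding F by (simp add: Q_def 1 nth \<tau>_def)
          \<comment> \<open>At the zero point \<open>det T - 1\<close> equals -1, as
            \<open>g\<close> is positive.\<close>
          show "(\<lambda>_. 0) \<in> Q k" by (simp add: Q_def 1)
          show "eval (slice (\<lambda>_. 0)) ?F \<noteq> 0" unfolding F using g by (simp add: power_0_left)
        qed
      next
        case 2
        let ?F = "det (pencil g (\<alpha> i))"
        have F: "eval (slice q) ?F = (\<Prod>j<g. \<alpha> i - q (1, j, j))" if "q (0, 0, 0) = 1" for q
          by (simp only: eval.hom_det[symmetric] map_eval_pencil pencil_at_slice[of q, OF that] det_diag_of)
        \<comment> \<open>The diagonal entries from position \<open>i\<close> on are set to
          \<open>\<alpha> g\<close>, a value outside those indexed below \<open>g\<close>; thus no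
          entry equals \<open>\<alpha> i\<close> and the product does not vanish.\<close>
        define q where "q = (\<lambda>(l :: nat, a, b :: nat). if l = 0 then 1 else if a < i then \<alpha> a else \<alpha> g)"
        show ?thesis
        proof (intro exI conjI ballI)
          show "?F \<in> carrier (SL_invariant_ring g r)" by (rule det_pencil_invariant) fact
          show "eval (slice q) ?F = 0" if q: "q \<in> Q (Suc k)" for q
          proof -
            have "q (vs ! 0) = \<tau> (vs ! 0)" "q (vs ! Suc i) = \<tau> (vs ! Suc i)"
              using q 2 by (auto simp: Q_def)
            then have "q (0, 0, 0) = 1" "q (1, i, i) = \<alpha> i" using 2 by (simp_all add: nth \<tau>_def)
            then show ?thesis using 2 F[of q] by (auto intro!: prod_zero bexI[of _ i])
          qed
          show "q \<in> Q k"
            unfolding Q_def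
          proof (intro CollectI allI impI)
            fix j assume "j < k"
            then show "q (vs ! j) = \<tau> (vs ! j)"
              using 2 by (cases j) (auto simp: nth q_def \<tau>_def)
          qed
          have "q (0, 0, 0) = 1" by (simp add: q_def)
          from F[of q, OF this] show "eval (slice q) ?F \<noteq> 0"
            using \<alpha> 2 by (auto simp: q_def inj_def)
        qed
      next
        case 3
        obtain l i j where v: "vs ! k = (l, i, j)" by (cases "vs ! k")
        \<comment> \<open>The scalar and the \<open>g\<close> diagonal coordinates occupy the first
          \<open>Suc g\<close> positions of \<open>vs\<close>.\<close>
        have "vs ! k = xs ! (k - Suc g)" "k - Suc g < length xs"
          using 3 k by (auto simp: vs_def nth_append nth_Cons')
        then have "(l, i, j) \<in> slice_rest g r" using v xs(1) nth_mem by metis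
        then have lij: "2 \<le> l" "l \<le> r" "i \<le> j" "j < g" by (auto simp: slice_rest_def)
        let ?F = "tr_invariant g (\<alpha> i) (\<alpha> j) l"
        obtain \<kappa> where \<kappa>: "\<kappa> \<noteq> 0" "\<And>q. q (0, 0, 0) = 1 \<Longrightarrow> (\<And>a. a < g \<Longrightarrow> q (1, a, a) = \<alpha> a) \<Longrightarrow>
            eval (slice q) ?F = \<kappa> * q (l, i, j) ^ 2"
          using eval_tr_invariant_slice[OF \<alpha> lij(3,4,1)] by blast
        have F: "eval (slice q) ?F = \<kappa> * q (l, i, j) ^ 2" if q: "q \<in> Q k" for q
        proof (rule \<kappa>(2))
          have q': "q (vs ! m) = \<tau> (vs ! m)" if "m < k" for m using q that by (simp add: Q_def)
          show "q (0, 0, 0) = 1" using q'[of 0] 3 by (simp add: nth \<tau>_def)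
          show "q (1, a, a) = \<alpha> a" if "a < g" for a
            using q'[of "Suc a"] 3 that by (simp add: nth \<tau>_def)
        qed
        \<comment> \<open>Only the coordinate about to be fixed is moved away from its target value
          0; distinctness of \<open>vs\<close> leaves the earlier ones intact.\<close>
        define q where "q = \<tau>((l, i, j) := 1)"
        have q: "q \<in> Q k"
          unfolding Q_def
        proof (intro CollectI allI impI)
          fix m assume m: "m < k"
          then have "vs ! m \<noteq> vs ! k" using vs(2) k by (simp add: nth_eq_iff_index_eq)
          then show "q (vs ! m) = \<tau> (vs ! m)" by (simp add: q_def v)
        qed
        show ?thesis
        proof (intro exI conjI ballI)
          show "?F \<in> carrier (SL_invariant_ring g r)" using r lij by (intro tr_invariant_invariant)
          show "eval (slice q) ?F = 0" if q: "q \<in> Q (Suc k)" for q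
          proof -
            have "q \<in> Q k" "q (vs ! k) = \<tau> (vs ! k)" using q by (auto simp: Q_def)
            then show ?thesis using lij by (simp add: F v \<tau>_def)
          qed
          show "q \<in> Q k" by fact
          show "eval (slice q) ?F \<noteq> 0" unfolding F[OF q] using \<kappa>(1) by (simp add: q_def)
        qed
      qed
    qed
    then show "P k \<noteq> P (Suc k)" unfolding P_def by blast
  qed
  ultimately show ?thesis unfolding len by blast
qed

section \<open>Density of the orbits meeting the slice\<close>

lemma generic_point_diagonalisable:
  fixes p :: "tvar \<Rightarrow> 'k::alg_closed_field"
  assumes g: "g \<ge> 1" and det: "det (sym_mat g p 0) \<noteq> 0"
    "det (char_deriv_mat (adj_mat (sym_mat g p 0) * sym_mat g p 1)) \<noteq> 0"
  obtains L where "L \<in> carrier_mat g g" "det L = 1"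
    "\<And>v. v \<in> tvars g r \<Longrightarrow>
       sym_act g L p v = slice (\<lambda>v. if v \<in> slice_vars g r then sym_act g L p v else 0) v"
proof -
  obtain W c where W: "W \<in> carrier_mat g g" "det W = 1"
      "transpose_mat W * sym_mat g p 0 * W = c \<cdot>\<^sub>m 1\<^sub>m g" "diagonal_mat (transpose_mat W * sym_mat g p 1 * W)"
    using simultaneous_diagonalisation[of "sym_mat g p 0" g "sym_mat g p 1"] g det by auto
  \<comment> \<open>The diagonalisation is written with \<open>W\<close> on the right, so the group
    element acting by congruence is its transpose.\<close>
  let ?L = "transpose_mat W" and ?p = "sym_act g (transpose_mat W) p"
  have L: "?L \<in> carrier_mat g g" using W by simp
  have p0: "sym_mat g ?p 0 = c \<cdot>\<^sub>m 1\<^sub>m g" and p1: "diagonal_mat (sym_mat g ?p 1)"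
    unfolding sym_mat_act[OF L] using W by simp_all
  have entry: "?p (l, i, j) = sym_mat g ?p l $$ (i, j)" if "i \<le> j" "j < g" for l i j
    using that by (simp only: sym_mat_index min_absorb1 max_absorb2 le_less_trans)
  have e0: "?p (0, i, j) = (if i = j then c else 0)" if "i \<le> j" "j < g" for i j
    unfolding entry[OF that] p0 using that by simp
  have e1: "?p (1, i, j) = 0" if "i < j" "j < g" for i j
    using p1 that unfolding entry[OF less_imp_le[OF that(1)] that(2)] by (simp add: diagonal_mat_def)
  show ?thesis
  proof (rule that[OF L])
    show "det ?L = 1" using W by (simp add: det_transpose[of _ g])
    fix v assume "v \<in> tvars g r"
    then obtain l i j where v: "v = (l, i, j)" "l \<le> r" "i \<le> j" "j < g" by (auto simp: tvars_def)
    have 0: "(0, 0, 0) \<in> slice_vars g r" by (simp add: slice_vars_def)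
    consider "l = 0" | "l = 1" "i = j" | "l = 1" "i < j" | "2 \<le> l" using v by fastforce
    then show "?p v = slice (\<lambda>v. if v \<in> slice_vars g r then ?p v else 0) v"
    proof cases
      case 1
      then show ?thesis using v g 0 e0[of i j] e0[of 0 0] by (simp add: slice_def)
    next
      case 2
      then have "(1, i, i) \<in> slice_vars g r" using v by (auto simp: slice_vars_def)
      then show ?thesis using v 2 by (simp add: slice_def)
    next
      case 3
      then show ?thesis using v e1[of i j] by (simp add: slice_def)
    next
      case 4
      then have "(l, i, j) \<in> slice_vars g r" using v by (auto simp: slice_vars_def slice_rest_def)
      then show ?thesis using v 4 by (simp add: slice_def)
    qed
  qed
qed

text \<open>The unit vectors are eigenvectors, so the matrix is diagonal with entries the derivative
  of the characteristic polynomial at \<open>\<alpha> i\<close>, a product of differences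
  \<open>\<alpha> i - \<alpha> j\<close>. This provides a point where the genericity condition
  holds.\<close>

lemma char_deriv_mat_diag_of:
  fixes \<alpha> :: "nat \<Rightarrow> 'k::field"
  assumes \<alpha>: "inj \<alpha>" and n: "n > 0"
  shows "det (char_deriv_mat (diag_of n \<alpha>)) \<noteq> 0"
proof -
  let ?M = "diag_of n \<alpha>"
  have M: "?M \<in> carrier_mat n n" by simp
  have cp: "char_poly ?M = (\<Prod>i<n. [:- \<alpha> i, 1:])"
  proof -
    have "char_poly ?M = (\<Prod>a\<leftarrow>diag_mat ?M. [:- a, 1:])"
      by (rule char_poly_upper_triangular[OF M]) (auto simp: upper_triangular_def)
    also have "diag_mat ?M = map \<alpha> [0..<n]" by (auto simp: diag_mat_def)
    also have "(\<Prod>a\<leftarrow>map \<alpha> [0..<n]. [:- a, 1:]) = (\<Prod>i<n. [:- \<alpha> i, 1:])"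
      using prod.distinct_set_conv_list[of "[0..<n]" "\<lambda>i. [:- \<alpha> i, 1:]"]
      by (simp add: o_def atLeast0LessThan)
    finally show ?thesis .
  qed
  have deriv: "poly (pderiv (char_poly ?M)) (\<alpha> i) \<noteq> 0" if i: "i < n" for i
  proof -
    have "char_poly ?M = [:- \<alpha> i, 1:] * (\<Prod>j\<in>{..<n} - {i}. [:- \<alpha> j, 1:])"
      unfolding cp using i by (intro prod.remove) auto
    then have "poly (pderiv (char_poly ?M)) (\<alpha> i) = (\<Prod>j\<in>{..<n} - {i}. \<alpha> i - \<alpha> j)"
      by (simp only: pderiv_mult poly_add poly_mult poly_prod) (simp add: pderiv_pCons)
    then show ?thesis using \<alpha> by (auto simp: inj_def)
  qed
  have "char_deriv_mat ?M = diag_of n (\<lambda>i. poly (pderiv (char_poly ?M)) (\<alpha> i))"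
  proof (rule eq_matI)
    fix a i assume "a < dim_row (diag_of n (\<lambda>i. poly (pderiv (char_poly ?M)) (\<alpha> i)))"
      "i < dim_col (diag_of n (\<lambda>i. poly (pderiv (char_poly ?M)) (\<alpha> i)))"
    then have ai: "a < n" "i < n" by auto
    have ev: "eigenvector ?M (unit_vec n i) (\<alpha> i)"
      unfolding eigenvector_def using ai by (auto simp: scalar_prod_right_unit intro!: eq_vecI)
    have "char_deriv_mat ?M $$ (a, i) = (char_deriv_mat ?M *\<^sub>v unit_vec n i) $ a"
      using ai carrier_matD[OF char_deriv_mat_carrier[OF M]] by (simp add: scalar_prod_right_unit)
    also have "\<dots> = (poly (pderiv (char_poly ?M)) (\<alpha> i) \<cdot>\<^sub>v unit_vec n i) $ a"
      by (simp only: char_deriv_mat_eigenvector[OF M ev n])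
    finally show "char_deriv_mat ?M $$ (a, i) = diag_of n (\<lambda>i. poly (pderiv (char_poly ?M)) (\<alpha> i)) $$ (a, i)"
      using ai by simp
  qed (auto simp: char_deriv_mat_def)
  then show ?thesis using deriv by (simp add: det_diag_of)
qed

text \<open>Where \<open>D\<close> is nonzero the orbit of the point meets the slice, so
  \<open>F\<close> vanishes there by invariance. Hence \<open>F * D\<close> vanishes everywhere, and
  irreducibility of affine space removes \<open>D\<close>.\<close>

lemma invariant_vanishing_on_slice:
  fixes F :: "'k::alg_closed_field tpoly"
  assumes g: "g \<ge> 1" and F: "F \<in> carrier (SL_invariant_ring g r)"
    and vanish: "\<And>q. eval (slice (\<lambda>v. if v \<in> slice_vars g r then q v else 0)) F = 0"
  shows "F = 0"
proof (rule eval_eq_0_imp_eq_0)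
  fix p
  let ?M = "adj_mat (generic_sym_mat g 0) * generic_sym_mat g 1 :: 'k tpoly mat"
  \<comment> \<open>Nonvanishing of \<open>D\<close> is the hypothesis of the diagonalisation:
    \<open>T\<close> invertible and all eigenvalues of \<open>adj_mat T * T'\<close> simple.\<close>
  define D where "D = det (generic_sym_mat g 0) * det (char_deriv_mat ?M)"
  have G: "generic_sym_mat g l \<in> carrier_mat g g" for l by simp
  have adjG: "adj_mat (generic_sym_mat g 0) \<in> carrier_mat g g" by (rule adj_mat(1)) simp
  have D: "eval p D = det (sym_mat g p 0) * det (char_deriv_mat (adj_mat (sym_mat g p 0) * sym_mat g p 1))" for p
    unfolding D_def eval.hom_mult eval.hom_det[symmetric]
      eval.char_deriv_mat_hom[OF mult_carrier_mat[OF adjG G], symmetric] eval.mat_hom_mult[OF adjG G]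
      eval.adj_mat_hom map_eval_generic_sym_mat ..
  obtain \<alpha> :: "nat \<Rightarrow> 'k" where \<alpha>: "inj \<alpha>" using ex_inj_nat_alg_closed by blast
  \<comment> \<open>The witness has \<open>T\<close> the identity and \<open>T'\<close> diagonal
    with distinct entries.\<close>
  define q where "q = (\<lambda>(l :: nat, i, j :: nat). if l = 0 then 1 else \<alpha> i)"
  have S0: "sym_mat g (slice q) 0 = 1\<^sub>m g"
    unfolding sym_mat_slice_0 by (auto simp: q_def)
  have S1: "sym_mat g (slice q) 1 = diag_of g \<alpha>"
    unfolding sym_mat_slice_1 by (rule eq_matI) (auto simp: q_def)
  have "(1 :: 'k) \<cdot>\<^sub>m 1\<^sub>m g = 1\<^sub>m g" by (rule eq_matI) auto
  then have "adj_mat (1\<^sub>m g :: 'k mat) = 1\<^sub>m g"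
    using adj_mat[of "1\<^sub>m g :: 'k mat" g] left_mult_one_mat[of "adj_mat (1\<^sub>m g :: 'k mat)" g g] by simp
  then have D0: "eval (slice q) D \<noteq> 0"
    unfolding D S0 S1 using char_deriv_mat_diag_of[OF \<alpha>, of g] g by simp
  have "eval p (F * D) = 0" for p
  proof (cases "eval p D = 0")
    case False
    then obtain L where L: "L \<in> carrier_mat g g" "det L = 1"
      "\<And>v. v \<in> tvars g r \<Longrightarrow>
         sym_act g L p v = slice (\<lambda>v. if v \<in> slice_vars g r then sym_act g L p v else 0) v"
      using generic_point_diagonalisable[OF g, of p r] unfolding D by auto
    have "eval p F = eval (sym_act g L p) F" using invariantD[OF F L(1,2)] by simp
    also have "\<dots> = eval (slice (\<lambda>v. if v \<in> slice_vars g r then sym_act g L p v else 0)) F"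
      by (rule eval_cong_tvars[OF invariant_tpoly[OF F] L(3)])
    also have "\<dots> = 0" by (rule vanish)
    finally show ?thesis by (simp add: eval.hom_mult)
  qed (simp add: eval.hom_mult)
  then show "eval p F = 0"
    using eval_irreducible[of UNIV F D "slice q" p] D0 by simp
qed

section \<open>Upper bound: the length of chains of primes\<close>

lemma prime_chain_length_le:
  fixes P :: "nat \<Rightarrow> 'k::alg_closed_field tpoly set"
  assumes g: "g \<ge> 1"
    and P: "\<And>i. i \<le> n \<Longrightarrow> primeideal (P i) (SL_invariant_ring g r)" "\<And>i. i < n \<Longrightarrow> P i \<subset> P (Suc i)"
  shows "n \<le> card (slice_vars g r)"
proof (rule ccontr)
  assume less: "\<not> n \<le> card (slice_vars g r)"
  \<comment> \<open>Only the first \<open>N\<close> steps of the chain are used, one more than the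
    number of slice coordinates.\<close>
  define N where "N = Suc (card (slice_vars g r))"
  then have N: "N \<le> n" using less by simp
  have "\<exists>x. x \<in> P (Suc i) - P i" if "i < n" for i using P(2)[OF that] by blast
  then obtain x where x: "\<And>i. i < n \<Longrightarrow> x i \<in> P (Suc i) - P i" by metis
  have xA: "x i \<in> carrier (SL_invariant_ring g r)" if "i < N" for i
  proof -
    interpret primeideal "P (Suc i)" "SL_invariant_ring g r" using P(1)[of "Suc i"] that N by simp
    show ?thesis using x[of i] that N a_subset by auto
  qed
  define \<rho> where "\<rho> q = slice (\<lambda>v. if v \<in> slice_vars g r then q v else 0)" for q :: "tvar \<Rightarrow> 'k"
  have var: "(\<lambda>q :: tvar \<Rightarrow> 'k. if v \<in> slice_vars g r then q v else 0) \<in> poly_funs (slice_vars g r) 1" for v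
    using poly_funs_var[OF finite_slice_vars, of v g r] poly_funs_const[of 0] by (cases "v \<in> slice_vars g r") auto
  \<comment> \<open>Each coordinate of \<open>\<rho> q\<close> is either zero or a single coordinate
    of \<open>q\<close>, so it has degree at most 1.\<close>
  have \<rho>: "(\<lambda>q. \<rho> q w) \<in> poly_funs (slice_vars g r) 1" for w
  proof -
    obtain l i j where w: "w = (l, i, j)" by (cases w)
    show ?thesis
    proof (cases "l \<le> 1 \<and> i \<noteq> j")
      case True
      then have "(\<lambda>q. \<rho> q w) = (\<lambda>q. 0)" by (auto simp: \<rho>_def slice_def w)
      then show ?thesis by (simp only: poly_funs_const)
    next
      case False
      define v where "v = (if l = 0 then (0, 0, 0) else if l = 1 then (1, i, i) else (l, i, j))"
      have "(\<lambda>q. \<rho> q w) = (\<lambda>q. if v \<in> slice_vars g r then q v else 0)"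
        using False by (auto simp: \<rho>_def slice_def w v_def)
      then show ?thesis by (simp only: var)
    qed
  qed
  obtain E c where E: "finite E" "E \<noteq> {}" "\<And>e. e \<in> E \<Longrightarrow> length e = N" "\<And>e. e \<in> E \<Longrightarrow> c e \<noteq> 0"
    "\<And>q. (\<Sum>e\<in>E. c e * (\<Prod>i<N. eval (\<rho> q) (x i) ^ (e ! i))) = 0"
  proof (rule poly_funs_algebraically_dependent[OF finite_slice_vars, of g r N "\<lambda>i q. eval (\<rho> q) (x i)"])
    show "card (slice_vars g r) < N" by (simp add: N_def)
    show "\<exists>d. (\<lambda>q. eval (\<rho> q) (x i)) \<in> poly_funs (slice_vars g r) d" for i
      by (rule eval_comp_poly_funs[OF \<rho>])
  qed (blast intro: that)
  \<comment> \<open>The dependence found on the slice is lifted to the invariants themselves: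
    \<open>?H\<close> vanishes on the slice, hence is 0 and lies in \<open>P 0\<close>, against the
    independence along the chain.\<close>
  let ?H = "\<Sum>e\<in>E. tconst (c e) * (\<Prod>i<N. x i ^ (e ! i))"
  have sum: "(\<Sum>i\<in>I. f i) \<in> carrier (SL_invariant_ring g r)"
    if "\<And>i. i \<in> I \<Longrightarrow> f i \<in> carrier (SL_invariant_ring g r)" for I :: "nat list set" and f :: "_ \<Rightarrow> 'k tpoly"
    using that by (induction I rule: infinite_finite_induct) (auto intro: invariant_add invariant_0)
  have prod: "(\<Prod>i\<in>I. f i) \<in> carrier (SL_invariant_ring g r)"
    if "\<And>i. i \<in> I \<Longrightarrow> f i \<in> carrier (SL_invariant_ring g r)" for I :: "nat set" and f :: "_ \<Rightarrow> 'k tpoly"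
    using that by (induction I rule: infinite_finite_induct) (auto intro: invariant_mult invariant_1)
  have pow: "f ^ k \<in> carrier (SL_invariant_ring g r)"
    if "f \<in> carrier (SL_invariant_ring g r)" for f :: "'k tpoly" and k
    using that by (induction k) (auto intro: invariant_mult invariant_1)
  have "?H = 0"
  proof (rule invariant_vanishing_on_slice[OF g])
    show "?H \<in> carrier (SL_invariant_ring g r)"
      by (intro sum invariant_mult invariant_tconst prod pow xA) simp
    show "eval (slice (\<lambda>v. if v \<in> slice_vars g r then q v else 0)) ?H = 0" for q
      using E(5)[of q] by (simp add: \<rho>_def eval.hom_sum eval.hom_mult eval.hom_prod eval.hom_power)
  qed
  interpret P0: primeideal "P 0" "SL_invariant_ring g r" using P(1)[of 0] by simp
  have "0 \<in> P 0" using additive_subgroup.zero_closed[OF P0.additive_subgroup_axioms] by simp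
  moreover have "?H \<notin> P 0"
  proof (rule prime_chain_monomials_independent[OF _ _ _ _ comm_ring_hom_tconst])
    show "primeideal (P i) (SL_invariant_ring g r)" if "i \<le> N" for i using P(1) that N by simp
    show "P i \<subseteq> P (Suc i)" if "i < N" for i using P(2)[of i] that N by auto
    show "x i \<in> P (Suc i) - P i" if "i < N" for i using x that N by simp
  qed (use E in \<open>auto intro: invariant_tconst\<close>)
  ultimately show False using \<open>?H = 0\<close> by simp
qed

theorem theorem25:
  fixes g r :: nat
  assumes "g \<ge> 1" and "r \<ge> 1"
  shows "krull_dim (SL_invariant_ring g r :: 'k::alg_closed_field tpoly ring)
    = enat ((r + 1) * (g * (g + 1) div 2) - g\<^sup>2 + 1)"
  unfolding krull_dim_def card_slice_vars[OF assms(2), symmetric]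
proof (rule antisym)
  let ?X = "{n. \<exists>P :: nat \<Rightarrow> 'k tpoly set. (\<forall>i\<le>n. primeideal (P i) (SL_invariant_ring g r)) \<and> (\<forall>i<n. P i \<subset> P (Suc i))}"
  show "(SUP n\<in>?X. enat n) \<le> enat (card (slice_vars g r))"
    using prime_chain_length_le[OF assms(1)] by (intro SUP_least) auto
  have "card (slice_vars g r) \<in> ?X"
    using prime_chain_exists[OF assms] by simp
  then show "enat (card (slice_vars g r)) \<le> (SUP n\<in>?X. enat n)"
    by (rule SUP_upper)
qed

end
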